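(* Let $G=(V,E)$ be a 4-edge-connected, 4-regular graph. Then the everywhere $\frac{3}{4}$ vector for $G$ dominates a convex combination of incidence vectors of 2-edge-connected spanning subgraphs of $G$, and such a convex combination can be found in time polynomial in the size of $G$.
   Context: A 2-edge-connected spanning subgraph of $G$ is a subset $F\subseteq E$ such that $(V,F)$ is connected and remains connected after deleting any single edge; its incidence vector is $\chi^F\in\{0,1\}^E$. The everywhere $\alpha$ vector for $G$ is the vector in $\mathbb{R}^E$ with all coordinates $\alpha$. A vector $a$ dominates $b$ if $a_i\ge b_i$ coordinatewise. *)

theory Defs
  imports Complex_Main "HOL-Library.Indicator_Function" "HOL-Computational_Algebra.Polynomial"
begin

section \<open>Graphs\<close>

text \<open>
  A finite loopless undirected graph is given by its vertex set \<open>V\<close>, its edge set \<open>E\<close> and the map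
  \<open>ends\<close> sending an edge to the set of its two endpoints. Distinct edges may have the same
  endpoints; simple graphs are the instances in which \<open>E\<close> consists of two-element subsets of \<open>V\<close>
  and \<open>ends = id\<close>.
\<close>

definition graph :: "'v set \<Rightarrow> 'e set \<Rightarrow> ('e \<Rightarrow> 'v set) \<Rightarrow> bool" where
  "graph V E ends \<longleftrightarrow>
     finite V \<and> V \<noteq> {} \<and> finite E \<and> (\<forall>e\<in>E. ends e \<subseteq> V \<and> card (ends e) = 2)"

definition regular :: "nat \<Rightarrow> 'v set \<Rightarrow> 'e set \<Rightarrow> ('e \<Rightarrow> 'v set) \<Rightarrow> bool" where
  "regular d V E ends \<longleftrightarrow> (\<forall>v\<in>V. card {e\<in>E. v \<in> ends e} = d)"

definition connected_graph :: "'v set \<Rightarrow> 'e set \<Rightarrow> ('e \<Rightarrow> 'v set) \<Rightarrow> bool" where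
  "connected_graph V E ends \<longleftrightarrow>
     (\<forall>u\<in>V. \<forall>v\<in>V. (u, v) \<in> {(x, y). \<exists>e\<in>E. ends e = {x, y}}\<^sup>*)"

definition edge_connected :: "nat \<Rightarrow> 'v set \<Rightarrow> 'e set \<Rightarrow> ('e \<Rightarrow> 'v set) \<Rightarrow> bool" where
  "edge_connected k V E ends \<longleftrightarrow>
     (\<forall>X\<subseteq>E. card X < k \<longrightarrow> connected_graph V (E - X) ends)"

definition two_ec_spanning_subgraph ::
    "'v set \<Rightarrow> 'e set \<Rightarrow> ('e \<Rightarrow> 'v set) \<Rightarrow> 'e set \<Rightarrow> bool" where
  "two_ec_spanning_subgraph V E ends F \<longleftrightarrow>
     F \<subseteq> E \<and> connected_graph V F ends \<and> (\<forall>e\<in>F. connected_graph V (F - {e}) ends)"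


section \<open>Vectors indexed by edges\<close>

text \<open>Vectors in $\mathbb{R}^E$ are functions of which only the values on \<open>E\<close> matter.\<close>

definition everywhere :: "real \<Rightarrow> 'e \<Rightarrow> real" where
  "everywhere \<alpha> = (\<lambda>_. \<alpha>)"

definition dominates :: "'e set \<Rightarrow> ('e \<Rightarrow> real) \<Rightarrow> ('e \<Rightarrow> real) \<Rightarrow> bool" where
  "dominates E a b \<longleftrightarrow> (\<forall>e\<in>E. a e \<ge> b e)"

definition convex_combination_of_incidence ::
    "'e set \<Rightarrow> nat \<Rightarrow> (nat \<Rightarrow> real) \<Rightarrow> (nat \<Rightarrow> 'e set) \<Rightarrow> ('e \<Rightarrow> real) \<Rightarrow> bool" where
  "convex_combination_of_incidence E k w F x \<longleftrightarrow>
     (\<forall>j<k. 0 \<le> w j) \<and> (\<Sum>j<k. w j) = 1 \<and>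
     (\<forall>e\<in>E. x e = (\<Sum>j<k. w j * indicator (F j) e))"

definition dominates_two_ec_combination ::
    "'v set \<Rightarrow> 'e set \<Rightarrow> ('e \<Rightarrow> 'v set) \<Rightarrow> ('e \<Rightarrow> real) \<Rightarrow>
     nat \<Rightarrow> (nat \<Rightarrow> real) \<Rightarrow> (nat \<Rightarrow> 'e set) \<Rightarrow> bool" where
  "dominates_two_ec_combination V E ends a k w F \<longleftrightarrow>
     (\<forall>j<k. two_ec_spanning_subgraph V E ends (F j)) \<and>
     (\<exists>x. convex_combination_of_incidence E k w F x \<and> dominates E a x)"


section \<open>Random access programs and their running time\<close>

text \<open>
  The machine model is a structured random access machine: the memory consists of named unbounded
  arrays of natural numbers (a scalar variable is entry \<open>0\<close> of an array), and every assignment and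
  every evaluation of a guard costs one step. The only arithmetic operations are addition and
  truncated subtraction. A program is a fixed finite object, so one step increases the bit length
  of the largest number in memory by at most a constant depending on the program; hence polynomial
  time here coincides with polynomial time on Turing machines. (With multiplication at unit cost
  this would fail.)
\<close>

type_synonym state = "string \<Rightarrow> nat \<Rightarrow> nat"

datatype aexp = Const nat | Elem string aexp | Plus aexp aexp | Minus aexp aexp

datatype bexp = Less aexp aexp | Neg bexp | Conj bexp bexp

datatype com =
    Skip
  | Assign string aexp aexp
  | Seq com com
  | Cond bexp com com
  | While bexp com

fun aval :: "aexp \<Rightarrow> state \<Rightarrow> nat" where
  "aval (Const c) s = c"
| "aval (Elem x a) s = s x (aval a s)"
| "aval (Plus a b) s = aval a s + aval b s"
| "aval (Minus a b) s = aval a s - aval b s"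

fun bval :: "bexp \<Rightarrow> state \<Rightarrow> bool" where
  "bval (Less a b) s \<longleftrightarrow> aval a s < aval b s"
| "bval (Neg b) s \<longleftrightarrow> \<not> bval b s"
| "bval (Conj b c) s \<longleftrightarrow> bval b s \<and> bval c s"

text \<open>
  \<open>exec c s t s'\<close>: started in state \<open>s\<close>, program \<open>c\<close> halts after \<open>t\<close> steps in state \<open>s'\<close>;
  \<open>Assign x a b\<close> is \<open>x[a] := b\<close>.
\<close>

inductive exec :: "com \<Rightarrow> state \<Rightarrow> nat \<Rightarrow> state \<Rightarrow> bool" where
  Skip: "exec Skip s 1 s"
| Assign: "exec (Assign x a b) s 1 (s(x := (s x)(aval a s := aval b s)))"
| Seq: "exec c s t s' \<Longrightarrow> exec d s' u s'' \<Longrightarrow> exec (Seq c d) s (t + u) s''"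
| CondTrue: "bval b s \<Longrightarrow> exec c s t s' \<Longrightarrow> exec (Cond b c d) s (1 + t) s'"
| CondFalse: "\<not> bval b s \<Longrightarrow> exec d s t s' \<Longrightarrow> exec (Cond b c d) s (1 + t) s'"
| WhileFalse: "\<not> bval b s \<Longrightarrow> exec (While b c) s 1 s"
| WhileTrue: "bval b s \<Longrightarrow> exec c s t s' \<Longrightarrow> exec (While b c) s' u s'' \<Longrightarrow>
    exec (While b c) s (1 + t + u) s''"

lemma exec_deterministic:
  assumes "exec c s t s'" and "exec c s u s''"
  shows "t = u \<and> s' = s''"
  using assms
proof (induction arbitrary: u s'' rule: exec.induct)
  case (Skip s)
  then show ?case by (auto elim: exec.cases)
next
  case (Assign x a b s)
  then show ?case by (auto elim: exec.cases)
next
  case (Seq c s t s' d u s'')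
  from Seq.prems show ?case by cases (use Seq.IH in blast)+
next
  case (CondTrue b s c t s' d)
  from CondTrue.prems show ?case by cases (use CondTrue in blast)+
next
  case (CondFalse b s d t s' c)
  from CondFalse.prems show ?case by cases (use CondFalse in blast)+
next
  case (WhileFalse b s c)
  from WhileFalse.prems show ?case by cases (use WhileFalse in blast)+
next
  case (WhileTrue b s c t s' u s'')
  from WhileTrue.prems show ?case by cases (use WhileTrue in blast)+
qed


section \<open>Graphs as inputs, convex combinations as outputs\<close>

text \<open>
  A graph on the vertices \<open>0, \<dots>, n - 1\<close> is presented by \<open>n\<close> and the list \<open>es\<close> of the endpoint pairs
  of its edges; the edges are the positions in the list.
\<close>

definition list_ends :: "(nat \<times> nat) list \<Rightarrow> nat \<Rightarrow> nat set" where
  "list_ends es i = {fst (es ! i), snd (es ! i)}"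

definition input_state :: "nat \<Rightarrow> (nat \<times> nat) list \<Rightarrow> state" where
  "input_state n es = (\<lambda>x i.
     if x = ''n'' \<and> i = 0 then n
     else if x = ''m'' \<and> i = 0 then length es
     else if x = ''src'' \<and> i < length es then fst (es ! i)
     else if x = ''dst'' \<and> i < length es then snd (es ! i)
     else 0)"

text \<open>
  The output is a number \<open>k\<close> of subgraphs, rational weights with a common denominator, and the
  concatenation \<open>chi\<close> of the \<open>k\<close> incidence vectors, each of length \<open>m\<close>.
\<close>

definition output_number :: "state \<Rightarrow> nat" where
  "output_number s = s ''k'' 0"

definition output_weight :: "state \<Rightarrow> nat \<Rightarrow> real" where
  "output_weight s j = real (s ''num'' j) / real (s ''den'' 0)"

definition output_subgraph :: "nat \<Rightarrow> state \<Rightarrow> nat \<Rightarrow> nat set" where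
  "output_subgraph m s j = {i. i < m \<and> s ''chi'' (j * m + i) = 1}"

end

theory Submission
  imports Defs
begin

text \<open>
  Carr-Ravi splitting. Fix an edge \<open>z = uv\<close> of a 4-regular graph with all cuts at least 4, and signed edge
  costs \<open>c\<close>; let \<open>A\<close>, \<open>B\<close>, \<open>C\<close> be the other edges at \<open>v\<close>, with \<open>B\<close> the cheapest. Replace \<open>z\<close> and \<open>A\<close> by
  one edge, \<open>B\<close> and \<open>C\<close> by another, and delete \<open>v\<close>; or do the same with \<open>A\<close> and \<open>C\<close> exchanged. By
  posimodularity of cuts, at least one of the two results has all cuts at least 4 again. A
  2-edge-connected \<open>F\<close> of the smaller graph avoiding the new special edge lifts: \<open>B\<close> is always taken, and
  exactly one of \<open>A\<close>, \<open>C\<close>, namely \<open>C\<close> if and only if \<open>F\<close> uses the merged edge. Charging \<open>c C - c A\<close> to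
  the merged edge preserves the bound \<open>c F \<le> 2/3 \<cdot> c (E - {z})\<close>, because \<open>c B \<le> c A\<close>.

  So for every cost vector there is a 2-edge-connected \<open>F\<close> of cost at most 2/3 of the total. Run this
  oracle for \<open>64 m\<close> rounds, where \<open>m\<close> is the number of edges, charging an edge \<open>e \<noteq> z\<close> chosen \<open>N e\<close> times in
  the first \<open>r\<close> rounds its excess \<open>x e = 3 N e - 2 r\<close> (Blackwell approachability). The sum of the
  \<open>(x e)\<^sup>2\<close> grows by at most \<open>4 m\<close> per round, so finally \<open>x e \<le> 16 m\<close>, that is \<open>N e \<le> 48 m\<close>, and the
  uniform average of the sets found is at most 3/4 everywhere.
\<close>


section \<open>Splitting off a vertex of a 4-regular graph\<close>

definition cutset :: "'e set \<Rightarrow> ('e \<Rightarrow> 'v) \<Rightarrow> ('e \<Rightarrow> 'v) \<Rightarrow> 'v set \<Rightarrow> 'e set" where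
  "cutset E s d S = {e\<in>E. (s e \<in> S) \<noteq> (d e \<in> S)}"

definition valency :: "'e set \<Rightarrow> ('e \<Rightarrow> 'v) \<Rightarrow> ('e \<Rightarrow> 'v) \<Rightarrow> 'v \<Rightarrow> nat" where
  "valency E s d w = (\<Sum>e\<in>E. of_bool (s e = w) + of_bool (d e = w))"

definition cuts_ge :: "nat \<Rightarrow> 'v set \<Rightarrow> 'e set \<Rightarrow> ('e \<Rightarrow> 'v) \<Rightarrow> ('e \<Rightarrow> 'v) \<Rightarrow> bool" where
  "cuts_ge k V E s d \<longleftrightarrow> (\<forall>S\<subseteq>V. S \<noteq> {} \<longrightarrow> S \<noteq> V \<longrightarrow> k \<le> card (cutset E s d S))"

text \<open>An edge may be a loop at a vertex outside \<open>V\<close>. So edges consumed by a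
  splitting need not be removed: they are parked as loops at the deleted vertex, and
  \<open>E\<close> stays fixed through the whole sequence. Loops lie in no cut, but a loop at a
  vertex of \<open>V\<close> counts twice in \<open>valency\<close>.\<close>

definition four_graph :: "'v set \<Rightarrow> 'e set \<Rightarrow> ('e \<Rightarrow> 'v) \<Rightarrow> ('e \<Rightarrow> 'v) \<Rightarrow> bool" where
  "four_graph V E s d \<longleftrightarrow> finite V \<and> finite E \<and>
     (\<forall>e\<in>E. s e = d e \<or> s e \<in> V \<and> d e \<in> V) \<and>
     (\<forall>w\<in>V. valency E s d w = 4) \<and> cuts_ge 4 V E s d"

lemma card_cutset:
  "finite E \<Longrightarrow> card (cutset E s d S) = (\<Sum>e\<in>E. of_bool ((s e \<in> S) \<noteq> (d e \<in> S)))"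
  by (simp add: cutset_def sum.If_cases Int_def)

text \<open>Summing valencies over \<open>S\<close> gives \<open>4 * card S\<close> and counts cut
  edges once, inner edges twice. Parity later raises a cut of more than 4 edges to at least
  6.\<close>

lemma even_card_cutset:
  assumes "four_graph V E s d" "S \<subseteq> V"
  shows "even (card (cutset E s d S))"
proof -
  have fin: "finite S" "finite E"
    using assms finite_subset by (auto simp: four_graph_def)
  have "4 * card S = (\<Sum>w\<in>S. valency E s d w)"
    using assms by (simp add: four_graph_def subset_iff)
  also have "\<dots> = (\<Sum>e\<in>E. \<Sum>w\<in>S. of_bool (s e = w) + of_bool (d e = w))"
    unfolding valency_def by (rule sum.swap)
  also have "\<dots> = (\<Sum>e\<in>E. of_bool (s e \<in> S) + of_bool (d e \<in> S))"
    using fin by (intro sum.cong) (auto simp: sum.distrib of_bool_def)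
  also have "\<dots> = (\<Sum>e\<in>E. of_bool ((s e \<in> S) \<noteq> (d e \<in> S)) + 2 * of_bool (s e \<in> S \<and> d e \<in> S))"
    by (intro sum.cong) auto
  also have "\<dots> = card (cutset E s d S) + 2 * (\<Sum>e\<in>E. of_bool (s e \<in> S \<and> d e \<in> S))"
    using fin by (simp only: card_cutset sum.distrib sum_distrib_left)
  finally have "even (card (cutset E s d S) + 2 * (\<Sum>e\<in>E. of_bool (s e \<in> S \<and> d e \<in> S)))"
    by (metis dvd_triv_left even_mult_iff even_numeral)
  then show ?thesis by simp
qed

lemma cutset_complement:
  assumes "\<forall>e\<in>E. s e = d e \<or> s e \<in> V \<and> d e \<in> V"
  shows "cutset E s d (V - S) = cutset E s d S"
  using assms by (auto simp: cutset_def)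

text \<open>The summand 2 is the slack contributed by \<open>z\<close>.\<close>

lemma cutset_posimodular:
  assumes "finite E" "z \<in> E" "s z \<in> S \<inter> S'" "d z \<notin> S \<union> S'"
  shows "card (cutset E s d (S - S')) + card (cutset E s d (S' - S)) + 2
       \<le> card (cutset E s d S) + card (cutset E s d S')"
proof -
  let ?c = "\<lambda>S e. of_bool ((s e \<in> S) \<noteq> (d e \<in> S)) :: nat"
  have "(\<Sum>e\<in>E. ?c (S - S') e + ?c (S' - S) e + 2 * of_bool (e = z)) \<le> (\<Sum>e\<in>E. ?c S e + ?c S' e)"
    by (rule sum_mono) (use assms in \<open>auto simp: of_bool_def\<close>)
  moreover have "(\<Sum>e\<in>E. 2 * of_bool (e = z)) = (2::nat)"
    using assms by (simp add: of_bool_def flip: sum_distrib_left)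
  ultimately show ?thesis
    unfolding card_cutset[OF assms(1)] sum.distrib by simp
qed

text \<open>In the smaller graph \<open>A\<close> and \<open>B\<close> are loops, so their
  membership in \<open>F\<close> carries no information and is overwritten. The name
  \<open>C\<close> stands there for the merged edge of \<open>B\<close> and
  \<open>C\<close>.\<close>

definition lift_split :: "'e \<Rightarrow> 'e \<Rightarrow> 'e \<Rightarrow> 'e set \<Rightarrow> 'e set" where
  "lift_split A B C F = (F - {A, B}) \<union> {B} \<union> (if C \<in> F then {} else {A})"

locale splitting =
  fixes V :: "'v set" and E :: "'e set" and s d :: "'e \<Rightarrow> 'v" and z A B C :: 'e
  assumes four: "four_graph V E s d"
    and star: "cutset E s d {d z} = {z, A, B, C}"
    and dist: "distinct [z, A, B, C]"
begin

abbreviation "v \<equiv> d z"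
abbreviation "u \<equiv> s z"

definition oth :: "'e \<Rightarrow> 'v" where
  "oth e = (if s e = v then d e else s e)"

text \<open>Edge names are recycled: \<open>z\<close> becomes the merged edge from \<open>u\<close>
  to \<open>oth A\<close>, \<open>C\<close> the merged edge from \<open>oth B\<close> to
  \<open>oth C\<close>, and \<open>A\<close> and \<open>B\<close> become loops at the deleted vertex
  \<open>v\<close>.\<close>

definition s' :: "'e \<Rightarrow> 'v" where
  "s' = s(A := v, B := v, C := oth B)"

definition d' :: "'e \<Rightarrow> 'v" where
  "d' = d(z := oth A, A := v, B := v, C := oth C)"

text \<open>A cut showing that pairing \<open>z\<close> with \<open>A\<close> and \<open>B\<close> with \<open>C\<close> destroys 4-edge-connectivity.\<close>
definition bad :: bool where
  "bad \<longleftrightarrow> (\<exists>S\<subseteq>V - {v}. u \<in> S \<and> oth A \<in> S \<and> oth B \<notin> S \<and> oth C \<notin> S \<and> card (cutset E s d S) \<le> 4)"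

lemma finE: "finite E" and finV: "finite V"
  and ends_V: "e \<in> E \<Longrightarrow> s e = d e \<or> s e \<in> V \<and> d e \<in> V"
  and deg4: "w \<in> V \<Longrightarrow> valency E s d w = 4"
  and cuts4: "S \<subseteq> V \<Longrightarrow> S \<noteq> {} \<Longrightarrow> S \<noteq> V \<Longrightarrow> 4 \<le> card (cutset E s d S)"
  using four by (auto simp: four_graph_def cuts_ge_def)

lemma star_in: "z \<in> E" "A \<in> E" "B \<in> E" "C \<in> E"
  using star by (auto simp: cutset_def)

lemma star_ends:
  assumes "e \<in> {z, A, B, C}"
  shows "(s e = v \<and> d e = oth e \<or> d e = v \<and> s e = oth e) \<and> oth e \<noteq> v \<and> oth e \<in> V"
proof -
  have "e \<in> cutset E s d {v}" using assms star by simp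
  then have "e \<in> E" "(s e = v) \<noteq> (d e = v)" by (auto simp: cutset_def)
  then show ?thesis using ends_V[of e] unfolding oth_def by auto
qed

lemma u_ne_v: "u \<noteq> v" "u \<in> V" "v \<in> V" "oth z = u"
  using star_ends[of z] ends_V[of z] star_in by (auto simp: oth_def)

lemma rest_v:
  assumes "e \<in> E - {z, A, B, C}"
  shows "s e = v \<longleftrightarrow> d e = v"
proof -
  have "e \<notin> cutset E s d {v}" using assms star by simp
  then show ?thesis using assms by (simp add: cutset_def)
qed

abbreviation "R \<equiv> E - {z, A, B, C}"

lemma sum_split: "(\<Sum>e\<in>E. f e) = f z + f A + f B + f C + (\<Sum>e\<in>R. f e)" for f :: "'e \<Rightarrow> 'a::comm_monoid_add"
proof -
  have "E = {z, A, B, C} \<union> R" using star_in by auto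
  then have "sum f E = sum f {z, A, B, C} + sum f R"
    using finE by (metis Diff_disjoint finite.emptyI finite_Diff finite_insert sum.union_disjoint)
  then show ?thesis using dist by (simp add: add_ac)
qed

lemma new_ends_R: "e \<in> R \<Longrightarrow> s' e = s e" "e \<in> R \<Longrightarrow> d' e = d e"
  by (auto simp: s'_def d'_def)

lemma new_ends:
  "s' z = u" "d' z = oth A" "s' A = v" "d' A = v" "s' B = v" "d' B = v" "s' C = oth B" "d' C = oth C"
  using dist by (auto simp: s'_def d'_def)

lemma R_sum_cong: "(\<And>e. e \<in> R \<Longrightarrow> f e = g e) \<Longrightarrow> sum f R = sum g R" for f :: "'e \<Rightarrow> nat"
  by (rule sum.cong) auto

lemma star_cross:
  assumes "v \<notin> S" "e \<in> {z, A, B, C}"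
  shows "((s e \<in> S) \<noteq> (d e \<in> S)) = (oth e \<in> S)"
    and "((s e \<in> insert v S) \<noteq> (d e \<in> insert v S)) = (oth e \<notin> S)"
  using star_ends[OF assms(2)] assms(1) by auto

lemma star_valency:
  assumes "w \<noteq> v" "e \<in> {z, A, B, C}"
  shows "of_bool (s e = w) + of_bool (d e = w) = (of_bool (oth e = w) :: nat)"
  using star_ends[OF assms(2)] assms(1) by auto

text \<open>Edges outside the star contribute the same number to all three cuts, so comparing the
  cuts amounts to comparing four bits, which tell the far ends that lie in \<open>S\<close>.\<close>

lemma cut_star:
  assumes "v \<notin> S"
  shows "card (cutset E s d S) = of_bool (u \<in> S) + of_bool (oth A \<in> S) + of_bool (oth B \<in> S)
    + of_bool (oth C \<in> S) + card (cutset R s d S)" (is ?thesis1)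
    and "card (cutset E s d (insert v S)) = of_bool (u \<notin> S) + of_bool (oth A \<notin> S) + of_bool (oth B \<notin> S)
    + of_bool (oth C \<notin> S) + card (cutset R s d S)" (is ?thesis2)
    and "card (cutset E s' d' S) = of_bool ((u \<in> S) \<noteq> (oth A \<in> S)) + of_bool ((oth B \<in> S) \<noteq> (oth C \<in> S))
      + card (cutset R s d S)" (is ?thesis3)
proof -
  have 1: "(\<Sum>e\<in>R. of_bool ((s e \<in> insert v S) \<noteq> (d e \<in> insert v S))) = (card (cutset R s d S))"
    unfolding card_cutset[OF finite_Diff[OF finE]]
  proof (rule R_sum_cong)
    fix e assume "e \<in> R"
    then show "of_bool ((s e \<in> insert v S) \<noteq> (d e \<in> insert v S)) = (of_bool ((s e \<in> S) \<noteq> (d e \<in> S)) :: nat)"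
      using rest_v[of e] assms by (cases "s e = v") simp_all
  qed
  have 2: "(\<Sum>e\<in>R. of_bool ((s' e \<in> S) \<noteq> (d' e \<in> S))) = (card (cutset R s d S))"
    unfolding card_cutset[OF finite_Diff[OF finE]] by (rule R_sum_cong) (simp add: new_ends_R)
  show ?thesis1
    unfolding card_cutset[OF finE] sum_split card_cutset[OF finite_Diff[OF finE]]
    using star_cross(1)[OF assms] u_ne_v by simp
  show ?thesis2
    unfolding card_cutset[OF finE] sum_split 1
    using star_cross(2)[OF assms] u_ne_v by simp
  show ?thesis3
    unfolding card_cutset[OF finE] sum_split 2 new_ends by simp
qed

text \<open>Unless \<open>S\<close> separates the pair \<open>u\<close>, \<open>oth A\<close> from
  the pair \<open>oth B\<close>, \<open>oth C\<close>, the new cut has the size of the old cut of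
  \<open>S\<close> or of \<open>insert v S\<close>. In the exceptional case both old cuts are larger
  by 2; the absence of bad cuts makes one of them exceed 4, and parity makes it at least 6.\<close>

lemma four_graph_split:
  assumes "\<not> bad"
  shows "four_graph (V - {v}) E s' d'"
proof -
  note ends = star_ends[of A] star_ends[of B] star_ends[of C] u_ne_v
  have endsV': "s' e = d' e \<or> s' e \<in> V - {v} \<and> d' e \<in> V - {v}" if "e \<in> E" for e
  proof (cases "e \<in> R")
    case True
    then show ?thesis using rest_v[OF True] ends_V[OF that] new_ends_R[OF True] by auto
  next
    case False
    then show ?thesis using that ends new_ends by auto
  qed
  have deg: "valency E s' d' w = 4" if "w \<in> V - {v}" for w
  proof -
    have "(\<Sum>e\<in>R. of_bool (s' e = w) + of_bool (d' e = w)) = (\<Sum>e\<in>R. of_bool (s e = w) + of_bool (d e = w) :: nat)"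
      by (rule R_sum_cong) (simp add: new_ends_R)
    then have "valency E s' d' w = valency E s d w"
      unfolding valency_def sum_split new_ends using star_valency[of w] that u_ne_v by (simp add: eq_commute[of v])
    then show ?thesis using deg4 that by simp
  qed
  have "4 \<le> card (cutset E s' d' S)" if S: "S \<subseteq> V - {v}" "S \<noteq> {}" "S \<noteq> V - {v}" for S
  proof -
    have vS: "v \<notin> S" and "S \<noteq> V" using S u_ne_v by auto
    note cs = cut_star[OF vS]
    have c1: "4 \<le> card (cutset E s d S)" using cuts4 S \<open>S \<noteq> V\<close> by auto
    have c2: "4 \<le> card (cutset E s d (insert v S))"
      by (rule cuts4) (use S u_ne_v in auto)
    have ev: "even (card (cutset E s d S))" "even (card (cutset E s d (insert v S)))"
      using even_card_cutset[OF four, of S] even_card_cutset[OF four, of "insert v S"] S(1) u_ne_v by blast+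
    have b1: "4 < card (cutset E s d S)" if "u \<in> S" "oth A \<in> S" "oth B \<notin> S" "oth C \<notin> S"
    proof (rule ccontr)
      assume "\<not> ?thesis"
      then have "bad" unfolding bad_def using S(1) that by (intro exI[of _ S]) simp
      then show False using assms by simp
    qed
    have b2: "4 < card (cutset E s d (insert v S))" if "u \<notin> S" "oth A \<notin> S" "oth B \<in> S" "oth C \<in> S"
    proof -
      \<comment> \<open>The opposite side of the same cut; it contains \<open>u\<close> and
        \<open>oth A\<close>, so it falls under the definition of \<open>bad\<close>.\<close>
      let ?T = "V - insert v S"
      have "insert v S = V - ?T" using S u_ne_v by auto
      moreover have "cutset E s d (V - ?T) = cutset E s d ?T"
        by (rule cutset_complement) (use ends_V in blast)
      ultimately have "card (cutset E s d (insert v S)) = card (cutset E s d ?T)" by simp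
      moreover have "\<not> card (cutset E s d ?T) \<le> 4"
      proof
        assume "card (cutset E s d ?T) \<le> 4"
        then have "bad" unfolding bad_def using S(1) that ends by (intro exI[of _ ?T]) auto
        then show False using assms by simp
      qed
      ultimately show ?thesis by simp
    qed
    show "4 \<le> card (cutset E s' d' S)"
    proof (cases "(u \<in> S \<longleftrightarrow> oth A \<in> S) \<and> (oth B \<in> S \<longleftrightarrow> oth C \<in> S) \<and> (u \<in> S \<longleftrightarrow> oth B \<notin> S)")
      case True
      then have "4 < card (cutset E s d S) \<or> 4 < card (cutset E s d (insert v S))"
        using b1 b2 by blast
      moreover have "card (cutset E s d S) = card (cutset E s' d' S) + 2"
         "card (cutset E s d (insert v S)) = card (cutset E s' d' S) + 2"
        unfolding cs using True by auto
      ultimately show ?thesis using ev by presburger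
    next
      case False
      then have "card (cutset E s d S) = card (cutset E s' d' S) \<or>
         card (cutset E s d (insert v S)) = card (cutset E s' d' S)"
        unfolding cs by (auto simp: of_bool_def)
      then show ?thesis using c1 c2 by auto
    qed
  qed
  then show ?thesis
    using finE finV endsV' deg unfolding four_graph_def cuts_ge_def by auto
qed

text \<open>Let \<open>S\<close> and \<open>S'\<close> be bad for the two pairings. As
  \<open>oth A\<close> lies only in \<open>S\<close> and \<open>oth C\<close> only in
  \<open>S'\<close>, both differences are nonempty and have cuts of at least 4 edges. Posimodularity
  with the slack from \<open>z\<close> would give \<open>4 + 4 + 2 \<le> 4 + 4\<close>.\<close>

lemma bad_swap:
  assumes "bad" "splitting.bad V E s d z C B A"
  shows False
proof -
  interpret sw: splitting V E s d z C B A
  proof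
    show "four_graph V E s d" by (rule four)
    show "cutset E s d {v} = {z, C, B, A}" unfolding star by (simp add: insert_commute)
    show "distinct [z, C, B, A]" using dist by auto
  qed
  note ends = star_ends[of A] star_ends[of B] star_ends[of C] u_ne_v
  obtain S where S: "S \<subseteq> V - {v}" "u \<in> S" "oth A \<in> S" "oth B \<notin> S" "oth C \<notin> S"
    "card (cutset E s d S) \<le> 4"
    using assms(1) bad_def by auto
  obtain S' where S': "S' \<subseteq> V - {v}" "u \<in> S'" "oth C \<in> S'" "oth B \<notin> S'" "oth A \<notin> S'"
    "card (cutset E s d S') \<le> 4"
    using assms(2) unfolding sw.bad_def by auto
  have "4 \<le> card (cutset E s d (S - S'))"
    by (rule cuts4) (use S S' ends in auto)
  moreover have "4 \<le> card (cutset E s d (S' - S))"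
    by (rule cuts4) (use S S' ends in auto)
  moreover have "card (cutset E s d (S - S')) + card (cutset E s d (S' - S)) + 2
       \<le> card (cutset E s d S) + card (cutset E s d S')"
    by (rule cutset_posimodular[of _ z]) (use S S' finE star_in in auto)
  ultimately show False using S S' by simp
qed

section \<open>Lifting an edge set and its cost\<close>

abbreviation "lift \<equiv> lift_split A B C"

text \<open>For a side \<open>S\<close> avoiding \<open>v\<close>, the edges of \<open>F\<close>
  that cross \<open>S\<close> after splitting inject into the lifted edges that cross it before:
  each goes to itself, except that the merged edge \<open>C\<close> goes to \<open>B\<close> when
  \<open>oth B\<close> is in \<open>S\<close>. The side \<open>V - {v}\<close> is crossed by
  \<open>B\<close> and by whichever of \<open>A\<close>, \<open>C\<close> was taken; sides
  containing \<open>v\<close> are complemented.\<close>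

lemma lift_cuts:
  assumes "F \<subseteq> E - {z}" "cuts_ge 2 (V - {v}) F s' d'"
  shows "cuts_ge 2 V (lift F) s d"
proof -
  note ends = star_ends[of A] star_ends[of B] star_ends[of C] u_ne_v
  have finF: "finite (lift F)"
    using assms finE finite_subset by (auto simp: lift_split_def)
  have subE: "lift F \<subseteq> E" using assms star_in by (auto simp: lift_split_def)
  have main: "2 \<le> card (cutset (lift F) s d S)" if S: "S \<subseteq> V - {v}" "S \<noteq> {}" for S
  proof (cases "S = V - {v}")
    case True
    have "{B, if C \<in> F then C else A} \<subseteq> cutset (lift F) s d S"
      using ends dist True by (auto simp: cutset_def lift_split_def)
    then have "card {B, if C \<in> F then C else A} \<le> card (cutset (lift F) s d S)"
      using finF by (intro card_mono) (auto simp: cutset_def)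
    moreover have "card {B, if C \<in> F then C else A} = 2" using dist by auto
    ultimately show ?thesis by simp
  next
    case False
    have vS: "v \<notin> S" using S by auto
    let ?f = "\<lambda>e. if e = C \<and> oth B \<in> S then B else e"
    have F2: "2 \<le> card (cutset F s' d' S)" using assms S False by (auto simp: cuts_ge_def)
    have cross: "?f e \<in> cutset (lift F) s d S" if e: "e \<in> cutset F s' d' S" for e
    proof -
      have "e \<noteq> A" "e \<noteq> B" "e \<noteq> z" "e \<in> F"
        using e assms(1) new_ends by (auto simp: cutset_def)
      then consider "e \<in> R" | "e = C" using assms(1) by auto
      then show ?thesis
      proof cases
        case 1
        then show ?thesis using e new_ends_R[OF 1] by (auto simp: cutset_def lift_split_def)
      next
        case 2
        have "(oth B \<in> S) \<noteq> (oth C \<in> S)"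
          using e new_ends 2 by (auto simp: cutset_def)
        moreover have "{B, C} \<subseteq> lift F" using \<open>e \<in> F\<close> 2 dist by (auto simp: lift_split_def)
        moreover have "(s x \<in> S) \<noteq> (d x \<in> S)" if "oth x \<in> S" "x \<in> {B, C}" for x
          using that star_ends[of x] vS by auto
        ultimately show ?thesis
          using 2 unfolding cutset_def by auto
      qed
    qed
    have "inj_on ?f (cutset F s' d' S)"
    proof -
      \<comment> \<open>After splitting \<open>B\<close> is a loop, so the value \<open>B\<close> is
        not taken twice.\<close>
      have "B \<notin> cutset F s' d' S" by (simp add: cutset_def new_ends)
      then show ?thesis unfolding inj_on_def by metis
    qed
    then have "card (cutset F s' d' S) \<le> card (cutset (lift F) s d S)"
    proof (rule card_inj_on_le)
      show "?f ` cutset F s' d' S \<subseteq> cutset (lift F) s d S" using cross by blast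
      show "finite (cutset (lift F) s d S)" using finF by (simp add: cutset_def)
    qed
    then show ?thesis using F2 by simp
  qed
  show ?thesis unfolding cuts_ge_def
  proof (intro allI impI)
    fix S assume S: "S \<subseteq> V" "S \<noteq> {}" "S \<noteq> V"
    show "2 \<le> card (cutset (lift F) s d S)"
    proof (cases "v \<in> S")
      case True
      have "cutset (lift F) s d S = cutset (lift F) s d (V - S)"
        using ends_V subE by (intro cutset_complement[symmetric]) auto
      then show ?thesis using main[of "V - S"] S True by auto
    next
      case False
      then show ?thesis using main[of S] S by auto
    qed
  qed
qed

text \<open>By default \<open>A\<close> and \<open>B\<close> are taken; using the merged edge
  replaces \<open>A\<close> by \<open>C\<close>, hence the difference. The zeros make the loops
  \<open>A\<close> and \<open>B\<close> free.\<close>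

definition c' :: "('e \<Rightarrow> int) \<Rightarrow> 'e \<Rightarrow> int" where
  "c' c = c(A := 0, B := 0, C := c C - c A)"

lemma sum_c':
  assumes "F \<subseteq> E"
  shows "sum c (lift F) = sum (c' c) F + c A + c B"
proof -
  have fin: "finite F" using assms finE finite_subset by blast
  let ?F = "F - {A, B, C}"
  have "sum c (lift F) = sum c ?F + c B + (if C \<in> F then c C else c A)"
  proof -
    have "lift F = insert B (insert (if C \<in> F then C else A) ?F)"
      unfolding lift_split_def using dist by auto
    moreover have "sum c (insert B (insert (if C \<in> F then C else A) ?F))
      = c B + (c (if C \<in> F then C else A) + sum c ?F)"
      using fin dist by auto
    ultimately show ?thesis by simp
  qed
  moreover have "sum (c' c) F = sum c ?F + (if C \<in> F then c C - c A else 0)"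
  proof -
    have "sum (c' c) F = sum (c' c) ?F + sum (c' c) (F \<inter> {A, B, C})"
      using fin by (metis add.commute sum.Int_Diff)
    moreover have "sum (c' c) ?F = sum c ?F"
      by (rule sum.cong) (auto simp: c'_def)
    moreover have "sum (c' c) (F \<inter> {A, B, C}) = (if C \<in> F then c C - c A else 0)"
    proof -
      have "sum (c' c) (F \<inter> {A, B, C}) = sum (c' c) (if C \<in> F then {C} else {})"
        by (rule sum.mono_neutral_right) (use dist fin in \<open>auto simp: c'_def\<close>)
      then show ?thesis using dist by (simp add: c'_def)
    qed
    ultimately show ?thesis by simp
  qed
  ultimately show ?thesis by simp
qed

text \<open>Lifting adds \<open>c A + c B\<close> to the cost of the set and
  \<open>2 * c A + c B\<close> to the total outside \<open>z\<close>. So the left side gains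
  \<open>3 * c A + 3 * c B\<close> and the right side \<open>4 * c A + 2 * c B\<close>, which
  suffices because \<open>c B \<le> c A\<close>.\<close>

lemma lift_cost:
  assumes "c B \<le> c A" "F \<subseteq> E - {z}" "3 * sum (c' c) F \<le> 2 * sum (c' c) (E - {z})"
  shows "3 * sum c (lift F) \<le> 2 * sum c (E - {z})"
proof -
  have "sum c E = c z + c A + c B + c C + sum c R" by (rule sum_split)
  moreover have "sum c E = c z + sum c (E - {z})"
    using finE star_in(1) by (simp add: sum.remove)
  moreover have "sum (c' c) E = c z + 0 + 0 + (c C - c A) + sum c R"
  proof -
    have "sum (c' c) R = sum c R" by (rule sum.cong) (auto simp: c'_def)
    then show ?thesis unfolding sum_split[of "c' c"] using dist by (simp add: c'_def)
  qed
  moreover have "sum (c' c) E = c z + sum (c' c) (E - {z})"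
    using finE star_in(1) dist by (simp add: sum.remove[of E z] c'_def)
  moreover have "sum c (lift F) = sum (c' c) F + c A + c B"
    using assms(2) by (intro sum_c') auto
  ultimately show ?thesis using assms(1,3) by linarith
qed

lemma lift_sub: "F \<subseteq> E - {z} \<Longrightarrow> lift F \<subseteq> E - {z}"
  using star_in dist by (auto simp: lift_split_def)

section \<open>Bad cuts described by deleting four edges\<close>

lemma bad_imp_closed:
  assumes "bad"
  obtains i j S where "i \<in> E - {B, C}" "j \<in> E - {B, C}" "u \<in> S" "v \<notin> S"
    "cutset (E - {z, A, i, j}) s d S = {}"
proof -
  obtain S where S: "S \<subseteq> V - {v}" "u \<in> S" "oth A \<in> S" "oth B \<notin> S" "oth C \<notin> S"
    "card (cutset E s d S) \<le> 4"
    using assms bad_def by auto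
  then have vS: "v \<notin> S" by auto
  let ?D = "cutset E s d S - {z, A}"
  have mem: "e \<in> cutset E s d S \<longleftrightarrow> oth e \<in> S" if "e \<in> {z, A, B, C}" for e
    using star_cross(1)[OF vS that] star_in that by (auto simp: cutset_def)
  have "{z, A} \<subseteq> cutset E s d S" using mem[of z] mem[of A] S u_ne_v by simp
  then have "card ?D \<le> 2" using S finE dist by (simp add: card_Diff_subset cutset_def)
  moreover have "finite ?D" using finE by (simp add: cutset_def)
  \<comment> \<open>If fewer than two further edges cross, the missing names are filled by
    \<open>z\<close> or by repetition.\<close>
  ultimately obtain i j where ij: "?D \<subseteq> {i, j}" "i \<in> insert z ?D" "j \<in> insert z ?D"
  proof -
    have "card ?D = 0 \<or> card ?D = 1 \<or> card ?D = 2" using \<open>card ?D \<le> 2\<close> by linarith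
    then consider "?D = {}" | i where "?D = {i}" | i j where "?D = {i, j}"
      using \<open>finite ?D\<close> by (metis card_0_eq card_1_singletonE card_2_iff)
    then show ?thesis
    proof cases
      case 1
      show ?thesis by (rule that[of z z]; unfold 1; simp)
    next
      case (2 i)
      show ?thesis by (rule that[of i i]; unfold 2; simp)
    next
      case (3 i j)
      show ?thesis by (rule that[of i j]; unfold 3; simp)
    qed
  qed
  have "B \<notin> ?D" "C \<notin> ?D" using mem[of B] mem[of C] S by auto
  moreover have "?D \<subseteq> E" by (auto simp: cutset_def)
  ultimately have "i \<in> E - {B, C}" "j \<in> E - {B, C}" using ij star_in dist by auto
  moreover have "cutset (E - {z, A, i, j}) s d S = {}" using ij(1) by (auto simp: cutset_def)
  ultimately show ?thesis using that S(2) vS by blast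
qed

text \<open>The cut of \<open>S\<close> lies within \<open>{z, A, i, j}\<close> and has at least 4
  edges, so it is that whole set. Hence \<open>A\<close> crosses while \<open>B\<close> and
  \<open>C\<close> do not, which places their far ends.\<close>

lemma closed_imp_bad:
  assumes "i \<notin> {B, C}" "j \<notin> {B, C}" "u \<in> S" "v \<notin> S" "S \<subseteq> V"
    "cutset (E - {z, A, i, j}) s d S = {}"
  shows bad
proof -
  let ?D = "cutset E s d S"
  have sub: "?D \<subseteq> {z, A, i, j}" using assms(6) by (auto simp: cutset_def)
  have "4 \<le> card ?D" by (rule cuts4) (use assms u_ne_v in auto)
  moreover have "card {z, A, i, j} \<le> 4" by (simp add: card_insert_if)
  ultimately have eq: "?D = {z, A, i, j}"
    using sub by (intro card_seteq) auto
  with \<open>card {z, A, i, j} \<le> 4\<close> have card: "card ?D \<le> 4" by simp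
  have mem: "e \<in> ?D \<longleftrightarrow> oth e \<in> S" if "e \<in> {z, A, B, C}" for e
    using star_cross(1)[OF assms(4) that] star_in that by (auto simp: cutset_def)
  have "oth A \<in> S" "oth B \<notin> S" "oth C \<notin> S"
    using mem[of A] mem[of B] mem[of C] assms(1,2) dist unfolding eq by auto
  then show ?thesis unfolding bad_def using assms(3-5) card by (intro exI[of _ S]) auto
qed

end


section \<open>A language of bounded loops\<close>

text \<open>The only loop is \<open>For x k p\<close>, which runs \<open>k * m\<close> rounds for a
  constant \<open>k\<close>. For well-formed programs this guarantees termination, and a polynomial
  time bound in \<open>m\<close> can be read off the syntax.\<close>

datatype prog =
    Nop
  | Asg string aexp aexp
  | Then prog prog (infixr \<open>;;\<close> 60)
  | If bexp prog prog
  | For string nat prog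

abbreviation Var :: "string \<Rightarrow> aexp" where
  "Var x \<equiv> Elem x (Const 0)"

primrec times_m :: "nat \<Rightarrow> aexp" where
  "times_m 0 = Const 0"
| "times_m (Suc k) = Plus (times_m k) (Var ''m'')"

primrec compile :: "prog \<Rightarrow> com" where
  "compile Nop = Skip"
| "compile (Asg x a b) = Assign x a b"
| "compile (p ;; q) = Seq (compile p) (compile q)"
| "compile (If b p q) = Cond b (compile p) (compile q)"
| "compile (For x k p) = Seq (Assign x (Const 0) (Const 0))
     (While (Less (Var x) (times_m k)) (Seq (compile p) (Assign x (Const 0) (Plus (Var x) (Const 1)))))"

primrec assigned :: "prog \<Rightarrow> string set" where
  "assigned Nop = {}"
| "assigned (Asg x a b) = {x}"
| "assigned (p ;; q) = assigned p \<union> assigned q"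
| "assigned (If b p q) = assigned p \<union> assigned q"
| "assigned (For x k p) = insert x (assigned p)"

primrec well_formed :: "prog \<Rightarrow> bool" where
  "well_formed Nop \<longleftrightarrow> True"
| "well_formed (Asg x a b) \<longleftrightarrow> x \<noteq> ''m''"
| "well_formed (p ;; q) \<longleftrightarrow> well_formed p \<and> well_formed q"
| "well_formed (If b p q) \<longleftrightarrow> well_formed p \<and> well_formed q"
| "well_formed (For x k p) \<longleftrightarrow> x \<noteq> ''m'' \<and> x \<notin> assigned p \<and> well_formed p"

definition put :: "string \<Rightarrow> nat \<Rightarrow> nat \<Rightarrow> state \<Rightarrow> state" where
  "put x i y s = s(x := (s x)(i := y))"

primrec iter :: "string \<Rightarrow> (state \<Rightarrow> state) \<Rightarrow> nat \<Rightarrow> state \<Rightarrow> state" where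
  "iter x f 0 s = put x 0 0 s"
| "iter x f (Suc i) s = put x 0 (Suc i) (f (iter x f i s))"

primrec den :: "prog \<Rightarrow> state \<Rightarrow> state" where
  "den Nop s = s"
| "den (Asg x a b) s = put x (aval a s) (aval b s) s"
| "den (p ;; q) s = den q (den p s)"
| "den (If b p q) s = (if bval b s then den p s else den q s)"
| "den (For x k p) s = iter x (den p) (k * s ''m'' 0) s"

text \<open>A conditional is charged for both branches, as an upper bound. Each round of a loop pays
  2 for the guard and the increment; the other 2 are the initial assignment and the final
  guard.\<close>

primrec cost :: "prog \<Rightarrow> nat poly" where
  "cost Nop = [:1:]"
| "cost (Asg x a b) = [:1:]"
| "cost (p ;; q) = cost p + cost q"
| "cost (If b p q) = [:1:] + cost p + cost q"
| "cost (For x k p) = [:2:] + [:0, k:] * (cost p + [:2:])"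

lemma put_other: "z \<noteq> x \<Longrightarrow> put x i y s z = s z"
  by (simp add: put_def)

lemma aval_times_m [simp]: "aval (times_m k) s = k * s ''m'' 0"
  by (induction k) auto

lemma iter_frame:
  assumes "\<And>s. f s y = s y" "y \<noteq> x"
  shows "iter x f i s y = s y"
  by (induction i) (auto simp: assms put_def)

lemma den_frame: "y \<notin> assigned p \<Longrightarrow> den p s y = s y"
  by (induction p arbitrary: s) (auto simp: put_def iter_frame)

lemma m_not_assigned: "well_formed p \<Longrightarrow> ''m'' \<notin> assigned p"
  by (induction p) auto

lemma den_m: "well_formed p \<Longrightarrow> den p s ''m'' = s ''m''"
  by (simp add: den_frame m_not_assigned)

lemma iter_index:
  assumes "\<And>s. f s x = s x"
  shows "iter x f i s x 0 = i"
  by (cases i) (auto simp: put_def)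

lemma exec_compile:
  assumes "well_formed p"
  shows "\<exists>t. exec (compile p) s t (den p s) \<and> t \<le> poly (cost p) (s ''m'' 0)"
  using assms
proof (induction p arbitrary: s)
  case Nop
  then show ?case by (auto intro!: exI[of _ 1] exec.intros)
next
  case (Asg x a b)
  then show ?case using exec.Assign[of x a b s] by (auto simp: put_def fun_upd_def)
next
  case (Then p q)
  obtain t where t: "exec (compile p) s t (den p s)" "t \<le> poly (cost p) (s ''m'' 0)"
    using Then by auto
  obtain u where u: "exec (compile q) (den p s) u (den q (den p s))"
      "u \<le> poly (cost q) (den p s ''m'' 0)"
    using Then by fastforce
  show ?case
    using exec.Seq[OF t(1) u(1)] t(2) u(2) Then.prems by (intro exI[of _ "t + u"]) (auto simp: den_m)
next
  case (If b p q)
  show ?case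
  proof (cases "bval b s")
    case True
    obtain t where t: "exec (compile p) s t (den p s)" "t \<le> poly (cost p) (s ''m'' 0)"
      using If by auto
    then show ?thesis using exec.CondTrue[OF True t(1)] True by (intro exI[of _ "1 + t"]) auto
  next
    case False
    obtain t where t: "exec (compile q) s t (den q s)" "t \<le> poly (cost q) (s ''m'' 0)"
      using If by auto
    then show ?thesis using exec.CondFalse[OF False t(1)] False by (intro exI[of _ "1 + t"]) auto
  qed
next
  case (For x k p)
  let ?m = "s ''m'' 0" and ?c = "poly (cost p) (s ''m'' 0)"
  let ?step = "Seq (compile p) (Assign x (Const 0) (Plus (Var x) (Const 1)))"
  let ?w = "While (Less (Var x) (times_m k)) ?step"
  let ?S = "\<lambda>i. iter x (den p) i s"
  have wf: "x \<noteq> ''m''" "x \<notin> assigned p" "well_formed p" using For.prems by auto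
  have m: "?S i ''m'' 0 = ?m" for i
    using wf by (subst iter_frame) (auto simp: den_m)
  have x: "?S i x 0 = i" for i
    using wf by (intro iter_index) (simp add: den_frame)
  \<comment> \<open>Induction on the number \<open>j\<close> of rounds still to run:
    \<open>exec\<close> unfolds a loop at its first round, whereas \<open>iter\<close> is built up
    at its last.\<close>
  have "\<exists>t. exec ?w (?S (k * ?m - j)) t (?S (k * ?m)) \<and> t \<le> 1 + j * (?c + 2)"
    if "j \<le> k * ?m" for j
    using that
  proof (induction j)
    case 0
    have "\<not> bval (Less (Var x) (times_m k)) (?S (k * ?m))" by (simp add: x m)
    then show ?case using exec.WhileFalse by fastforce
  next
    case (Suc j)
    let ?i = "k * ?m - Suc j"
    have i: "k * ?m - j = Suc ?i" using Suc.prems by simp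
    have b: "bval (Less (Var x) (times_m k)) (?S ?i)" using Suc.prems by (simp add: x m)
    obtain t where t: "exec (compile p) (?S ?i) t (den p (?S ?i))" "t \<le> ?c"
      using For.IH[OF wf(3), of "?S ?i"] m by auto
    have "exec (Assign x (Const 0) (Plus (Var x) (Const 1))) (den p (?S ?i)) 1 (?S (Suc ?i))"
      using exec.Assign[of x "Const 0" "Plus (Var x) (Const 1)" "den p (?S ?i)"] x[of ?i] wf
      by (simp add: put_def den_frame)
    then have step: "exec ?step (?S ?i) (t + 1) (?S (Suc ?i))"
      using exec.Seq[OF t(1)] by blast
    obtain u where u: "exec ?w (?S (Suc ?i)) u (?S (k * ?m))" "u \<le> 1 + j * (?c + 2)"
      using Suc i by auto
    have "exec ?w (?S ?i) (1 + (t + 1) + u) (?S (k * ?m))"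
      using exec.WhileTrue[OF b step u(1)] .
    then show ?case using t(2) u(2) by (intro exI[of _ "1 + (t + 1) + u"]) auto
  qed
  from this[of "k * ?m"] obtain t where
    t: "exec ?w (put x 0 0 s) t (?S (k * ?m))" "t \<le> 1 + k * ?m * (?c + 2)" by auto
  have "exec (Assign x (Const 0) (Const 0)) s 1 (put x 0 0 s)"
    using exec.Assign[of x "Const 0" "Const 0" s] by (simp add: put_def)
  from exec.Seq[OF this t(1)] show ?case
    using t(2) by (intro exI[of _ "1 + t"]) (auto simp: algebra_simps)
qed

lemma iter_inv:
  assumes "I 0 (put x 0 0 s)"
    and "\<And>i s. i < n \<Longrightarrow> s x 0 = i \<Longrightarrow> I i s \<Longrightarrow> I (Suc i) (put x 0 (Suc i) (f s))"
    and "\<And>s. f s x = s x"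
  shows "I n (iter x f n s)"
proof -
  have "i \<le> n \<Longrightarrow> I i (iter x f i s)" for i
    by (induction i) (auto simp: assms iter_index)
  then show ?thesis by simp
qed

lemma poly_nat_mono: "a \<le> b \<Longrightarrow> poly p a \<le> poly p (b::nat)" for p :: "nat poly"
  by (induction p) (auto intro: add_mono mult_mono)


section \<open>Testing admissibility of a splitting\<close>

lemma put_apply [simp]: "put x i y s z j = (if z = x \<and> j = i then y else s z j)"
  by (simp add: put_def)

text \<open>A Hoare rule. The invariant must be insensitive to the counter entry, which the loop
  itself overwrites; inside the body, every array that the loop does not write may be taken to be as
  on entry.\<close>

lemma For_inv:
  assumes "x \<notin> assigned p" "well_formed (For x k p)"
    and "\<And>i j s. I i (put x 0 j s) = I i s"
    and "I 0 s"
    and "\<And>i t. i < k * s ''m'' 0 \<Longrightarrow> t x 0 = i \<Longrightarrow> (\<And>y. y \<notin> insert x (assigned p) \<Longrightarrow> t y = s y)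
           \<Longrightarrow> I i t \<Longrightarrow> I (Suc i) (den p t)"
  shows "I (k * s ''m'' 0) (den (For x k p) s)"
proof -
  have "I (k * s ''m'' 0) (iter x (den p) (k * s ''m'' 0) s) \<and>
     (\<forall>y. y \<notin> insert x (assigned p) \<longrightarrow> iter x (den p) (k * s ''m'' 0) s y = s y)"
  proof (rule iter_inv[where I = "\<lambda>i t. I i t \<and> (\<forall>y. y \<notin> insert x (assigned p) \<longrightarrow> t y = s y)"])
    show "I 0 (put x 0 0 s) \<and> (\<forall>y. y \<notin> insert x (assigned p) \<longrightarrow> put x 0 0 s y = s y)"
      using assms(3,4) by (simp add: put_other)
    show "den p t x = t x" for t using assms(1) by (simp add: den_frame)
    show "I (Suc i) (put x 0 (Suc i) (den p t)) \<and>
       (\<forall>y. y \<notin> insert x (assigned p) \<longrightarrow> put x 0 (Suc i) (den p t) y = s y)"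
      if "i < k * s ''m'' 0" "t x 0 = i" "I i t \<and> (\<forall>y. y \<notin> insert x (assigned p) \<longrightarrow> t y = s y)" for i t
      using that assms(3,5) by (simp add: put_other den_frame)
  qed
  then show ?thesis by simp
qed

definition Eq :: "aexp \<Rightarrow> aexp \<Rightarrow> bexp" where
  "Eq a b = Conj (Neg (Less a b)) (Neg (Less b a))"

lemma bval_Eq [simp]: "bval (Eq a b) s \<longleftrightarrow> aval a s = aval b s"
  by (auto simp: Eq_def)

abbreviation Ne :: "aexp \<Rightarrow> aexp \<Rightarrow> bexp" where
  "Ne a b \<equiv> Neg (Eq a b)"

abbreviation Set :: "string \<Rightarrow> aexp \<Rightarrow> prog" where
  "Set x a \<equiv> Asg x (Const 0) a"

abbreviation When :: "bexp \<Rightarrow> prog \<Rightarrow> prog" where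
  "When b p \<equiv> If b p Nop"

section \<open>Reachability by repeated marking\<close>

definition sweep_edge :: prog where
  "sweep_edge =
     When (Conj (Conj (Ne (Var ''e'') (Const 0)) (Ne (Var ''e'') (Var ''A'')))
                (Conj (Ne (Var ''e'') (Var ''i'')) (Ne (Var ''e'') (Var ''j''))))
      (When (Eq (Elem ''mk'' (Elem ''s'' (Var ''e''))) (Const 1))
            (Asg ''mk'' (Elem ''d'' (Var ''e'')) (Const 1)) ;;
       When (Eq (Elem ''mk'' (Elem ''d'' (Var ''e''))) (Const 1))
            (Asg ''mk'' (Elem ''s'' (Var ''e'')) (Const 1)))"

definition sweep :: prog where
  "sweep = For ''e'' 1 sweep_edge"

definition clear :: prog where
  "clear = For ''e'' 1 (Asg ''mk'' (Elem ''s'' (Var ''e'')) (Const 0) ;;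
                        Asg ''mk'' (Elem ''d'' (Var ''e'')) (Const 0))"

definition reach :: prog where
  "reach = clear ;; Asg ''mk'' (Elem ''s'' (Const 0)) (Const 1) ;; For ''l'' 1 sweep"

text \<open>
  A bad cut consists of edge \<open>0\<close>, edge \<open>A\<close> and at most two more edges, neither of them \<open>B\<close> or \<open>C\<close>. So the
  test deletes all such quadruples in turn and checks that the ends of edge \<open>0\<close> stay connected.
\<close>

definition admissible_test :: prog where
  "admissible_test = Set ''ok'' (Const 1) ;;
     For ''i'' 1 (For ''j'' 1
       (When (Conj (Conj (Ne (Var ''i'') (Var ''B'')) (Ne (Var ''i'') (Var ''C'')))
                   (Conj (Ne (Var ''j'') (Var ''B'')) (Ne (Var ''j'') (Var ''C''))))
         (reach ;; When (Ne (Elem ''mk'' (Elem ''d'' (Const 0))) (Const 1)) (Set ''ok'' (Const 0)))))"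

abbreviation edges :: "state \<Rightarrow> nat set" where
  "edges st \<equiv> {..<st ''m'' 0}"

text \<open>Restricted to ends of edges because \<open>clear\<close> resets only those entries of
  \<open>mk\<close>.\<close>

definition marked :: "state \<Rightarrow> nat set" where
  "marked st = {w \<in> st ''s'' ` edges st \<union> st ''d'' ` edges st. st ''mk'' w = 1}"

definition live :: "state \<Rightarrow> nat set" where
  "live st = edges st - {0, st ''A'' 0, st ''i'' 0, st ''j'' 0}"

lemma assigned_reach [simp]:
  "assigned sweep_edge = {''mk''}"
  "assigned sweep = {''e'', ''mk''}"
  "assigned clear = {''e'', ''mk''}"
  "assigned reach = {''e'', ''mk'', ''l''}"
  "assigned admissible_test = {''e'', ''mk'', ''l'', ''i'', ''j'', ''ok''}"
  by (auto simp: sweep_edge_def sweep_def clear_def reach_def admissible_test_def)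

lemma well_formed_reach [simp]:
  "well_formed sweep_edge" "well_formed sweep" "well_formed clear" "well_formed reach"
  "well_formed admissible_test"
proof -
  show 1: "well_formed sweep_edge" by (simp add: sweep_edge_def)
  then show 2: "well_formed sweep" by (simp add: sweep_def)
  show 3: "well_formed clear" by (simp add: clear_def)
  show 4: "well_formed reach" using 2 3 by (simp add: reach_def)
  then show "well_formed admissible_test" by (simp add: admissible_test_def)
qed

lemma marked_cong:
  "\<lbrakk>t ''s'' = st ''s''; t ''d'' = st ''d''; t ''m'' = st ''m''; t ''mk'' = st ''mk''\<rbrakk> \<Longrightarrow> marked t = marked st"
  by (simp add: marked_def)

lemma live_cong:
  "\<lbrakk>t ''A'' = st ''A''; t ''i'' = st ''i''; t ''j'' = st ''j''; t ''m'' = st ''m''\<rbrakk> \<Longrightarrow> live t = live st"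
  by (simp add: live_def)

lemma marked_put [simp]:
  "x \<notin> {''s'', ''d'', ''m'', ''mk''} \<Longrightarrow> marked (put x i y st) = marked st"
  by (rule marked_cong) auto

lemma marked_sweep_edge:
  fixes st :: state
  defines "e \<equiv> st ''e'' 0"
  assumes "e < st ''m'' 0"
  shows "marked (den sweep_edge st) = marked st \<union>
    (if e \<in> live st \<and> (st ''s'' e \<in> marked st \<or> st ''d'' e \<in> marked st) then {st ''s'' e, st ''d'' e} else {})"
  using assms by (auto simp: sweep_edge_def marked_def live_def)

text \<open>A mark set early may spread further within the same sweep, so the exact result depends
  on the order of the edges. It is instead bounded from below by one step of propagation and from
  above by every closed set containing the old marks.\<close>

lemma marked_sweep:
  fixes st :: state
  defines "R' \<equiv> marked (den sweep st)"
  shows "marked st \<subseteq> R'"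
    and "\<And>T. marked st \<subseteq> T \<Longrightarrow> cutset (live st) (st ''s'') (st ''d'') T = {} \<Longrightarrow> R' \<subseteq> T"
    and "\<And>e. e \<in> live st \<Longrightarrow> st ''s'' e \<in> marked st \<or> st ''d'' e \<in> marked st \<Longrightarrow> {st ''s'' e, st ''d'' e} \<subseteq> R'"
proof -
  let ?I = "\<lambda>i t. marked st \<subseteq> marked t \<and>
     (\<forall>T. marked st \<subseteq> T \<longrightarrow> cutset (live st) (st ''s'') (st ''d'') T = {} \<longrightarrow> marked t \<subseteq> T) \<and>
     (\<forall>e\<in>live st. e < i \<longrightarrow> st ''s'' e \<in> marked st \<or> st ''d'' e \<in> marked st
         \<longrightarrow> {st ''s'' e, st ''d'' e} \<subseteq> marked t)"
  have I: "?I (1 * st ''m'' 0) (den sweep st)"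
    unfolding sweep_def
  proof (rule For_inv[where I = ?I])
    fix i t
    assume i: "i < 1 * st ''m'' 0" "t ''e'' 0 = i"
      and fr: "\<And>y. y \<notin> insert ''e'' (assigned sweep_edge) \<Longrightarrow> t y = st y" and I: "?I i t"
    have eqs: "t ''s'' = st ''s''" "t ''d'' = st ''d''" "t ''m'' = st ''m''" "live t = live st"
      by (simp_all add: fr) (rule live_cong; simp add: fr)
    have upd: "marked (den sweep_edge t) = marked t \<union>
      (if i \<in> live st \<and> (st ''s'' i \<in> marked t \<or> st ''d'' i \<in> marked t) then {st ''s'' i, st ''d'' i} else {})"
      using marked_sweep_edge[of t] i(1) unfolding i(2) eqs by simp
    have "marked st \<subseteq> marked (den sweep_edge t)" using I upd by blast
    moreover have "marked (den sweep_edge t) \<subseteq> T"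
      if "marked st \<subseteq> T" "cutset (live st) (st ''s'') (st ''d'') T = {}" for T
    proof -
      have "marked t \<subseteq> T" using I that by simp
      moreover have "i \<in> live st \<Longrightarrow> st ''s'' i \<in> T \<longleftrightarrow> st ''d'' i \<in> T"
        using that(2) by (auto simp: cutset_def)
      ultimately show ?thesis unfolding upd by auto
    qed
    moreover have "{st ''s'' e, st ''d'' e} \<subseteq> marked (den sweep_edge t)"
      if "e \<in> live st" "e < Suc i" "st ''s'' e \<in> marked st \<or> st ''d'' e \<in> marked st" for e
    proof (cases "e = i")
      case True
      then show ?thesis using that I unfolding upd by auto
    next
      case False
      then have "{st ''s'' e, st ''d'' e} \<subseteq> marked t" using that I by auto
      then show ?thesis unfolding upd by auto
    qed
    ultimately show "?I (Suc i) (den sweep_edge t)" by (intro conjI allI ballI impI)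
  qed simp_all
  have lt: "e < 1 * st ''m'' 0" if "e \<in> live st" for e using that by (simp add: live_def)
  show "marked st \<subseteq> R'" using I unfolding R'_def by blast
  show "R' \<subseteq> T" if "marked st \<subseteq> T" "cutset (live st) (st ''s'') (st ''d'') T = {}" for T
    using I that unfolding R'_def by simp
  show "{st ''s'' e, st ''d'' e} \<subseteq> R'"
    if "e \<in> live st" "st ''s'' e \<in> marked st \<or> st ''d'' e \<in> marked st" for e
    using I that lt[of e] unfolding R'_def by blast
qed

lemma den_clear:
  assumes "w \<in> st ''s'' ` edges st \<union> st ''d'' ` edges st"
  shows "den clear st ''mk'' w = 0"
proof -
  let ?I = "\<lambda>i t. \<forall>e<i. t ''mk'' (st ''s'' e) = (0::nat) \<and> t ''mk'' (st ''d'' e) = (0::nat)"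
  have "?I (1 * st ''m'' 0) (den clear st)"
    unfolding clear_def by (rule For_inv[where I = ?I]) (auto simp: less_Suc_eq)
  then show ?thesis using assms by auto
qed

text \<open>Connectivity of the ends of edge \<open>0\<close> after deleting \<open>X\<close>, in
  dual form: no set closed under the remaining edges contains \<open>s 0\<close> and misses
  \<open>d 0\<close>. This form matches the statements about cuts.\<close>

definition joined :: "nat \<Rightarrow> (nat \<Rightarrow> nat) \<Rightarrow> (nat \<Rightarrow> nat) \<Rightarrow> nat set \<Rightarrow> bool" where
  "joined m s d X \<longleftrightarrow> (\<forall>T. s 0 \<in> T \<longrightarrow> cutset ({..<m} - X) s d T = {} \<longrightarrow> d 0 \<in> T)"

text \<open>Until the marked set is closed, each sweep adds a vertex of \<open>V\<close>, so
  \<open>m\<close> sweeps suffice. The marks are then the smallest closed set containing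
  \<open>s 0\<close>, and this set decides \<open>joined\<close>.\<close>

lemma den_reach:
  assumes V: "finite V" "card V \<le> st ''m'' 0" "st ''s'' 0 \<in> V" "cutset (live st) (st ''s'') (st ''d'') V = {}"
    and m: "0 < st ''m'' 0"
  shows "den reach st ''mk'' (st ''d'' 0) = 1 \<longleftrightarrow>
    joined (st ''m'' 0) (st ''s'') (st ''d'') {0, st ''A'' 0, st ''i'' 0, st ''j'' 0}"
proof -
  let ?s = "st ''s''" and ?d = "st ''d''" and ?u = "st ''s'' 0"
  let ?cl = "\<lambda>T. cutset (live st) ?s ?d T = {}"
  \<comment> \<open>The strict \<open>l < card (marked t)\<close> holds at \<open>l = 0\<close>
    because the start vertex is marked; at \<open>l = m\<close> it contradicts
    \<open>card V \<le> m\<close>, so the set is closed.\<close>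
  let ?I = "\<lambda>l t. ?u \<in> marked t \<and> (\<forall>T. ?u \<in> T \<longrightarrow> ?cl T \<longrightarrow> marked t \<subseteq> T) \<and>
      (?cl (marked t) \<or> l < card (marked t))"
  define st1 where "st1 = den (Asg ''mk'' (Elem ''s'' (Const 0)) (Const 1)) (den clear st)"
  have fr1: "st1 y = st y" if "y \<notin> {''e'', ''mk''}" for y
    using that unfolding st1_def by (simp add: den_frame put_other)
  have eqs1: "st1 ''s'' = ?s" "st1 ''d'' = ?d" "st1 ''m'' = st ''m''"
    by (simp_all add: fr1)
  have mk1: "st1 ''mk'' w = (if w = ?u then 1 else den clear st ''mk'' w)" for w
    by (simp add: st1_def den_frame)
  have m1: "marked st1 = {?u}"
  proof -
    have "?u \<in> ?s ` edges st \<union> ?d ` edges st" using m by blast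
    moreover have "w = ?u" if "w \<in> ?s ` edges st \<union> ?d ` edges st" "st1 ''mk'' w = 1" for w
      using den_clear[OF that(1)] that(2) mk1[of w] by (cases "w = ?u") simp_all
    moreover have "st1 ''mk'' ?u = 1" by (simp add: mk1)
    ultimately show ?thesis unfolding marked_def eqs1 by blast
  qed
  have "?I (1 * st1 ''m'' 0) (den (For ''l'' 1 sweep) st1)"
  proof (rule For_inv[where I = ?I])
    fix l t
    assume fr: "\<And>y. y \<notin> insert ''l'' (assigned sweep) \<Longrightarrow> t y = st1 y" and I: "?I l t"
    have eqs: "t ''s'' = ?s" "t ''d'' = ?d" "t ''m'' = st ''m''" "live t = live st"
      by (simp_all add: fr fr1) (rule live_cong; simp add: fr fr1)
    note sw = marked_sweep[where st = t, unfolded eqs]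
    have "marked t \<subseteq> V" using I V by simp
    then have sub: "marked (den sweep t) \<subseteq> V" using V(4) by (rule sw(2))
    have "?cl (marked (den sweep t)) \<or> Suc l < card (marked (den sweep t))"
    proof (cases "?cl (marked t)")
      case True
      then have "marked (den sweep t) = marked t" using sw(1) sw(2)[OF subset_refl] by (intro antisym)
      then show ?thesis using True by simp
    next
      case False
      then obtain e where "e \<in> live st" "(?s e \<in> marked t) \<noteq> (?d e \<in> marked t)"
        by (auto simp: cutset_def)
      then have "marked t \<subset> marked (den sweep t)" using sw(1) sw(3)[of e] by blast
      then have "card (marked t) < card (marked (den sweep t))"
        using sub V(1) finite_subset by (intro psubset_card_mono) auto
      then show ?thesis using False I by auto
    qed
    moreover have "?u \<in> marked (den sweep t)" using I sw(1) by blast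
    moreover have "marked (den sweep t) \<subseteq> T" if "?u \<in> T" "?cl T" for T
    proof -
      have "marked t \<subseteq> T" using I that by simp
      then show ?thesis using that(2) by (rule sw(2))
    qed
    ultimately show "?I (Suc l) (den sweep t)" by (intro conjI allI impI)
  qed (simp_all add: m1)
  moreover have "den reach st = den (For ''l'' 1 sweep) st1"
    by (simp add: reach_def st1_def)
  ultimately have I: "?I (st ''m'' 0) (den reach st)" using eqs1(3) by simp
  let ?R = "marked (den reach st)"
  have "?R \<subseteq> V" using I V by simp
  then have "card ?R \<le> st ''m'' 0" using V(1,2) card_mono le_trans by blast
  then have cl: "?cl ?R" using I by auto
  have "?d 0 \<in> ?R \<longleftrightarrow> den reach st ''mk'' (?d 0) = 1"
    using m by (auto simp: marked_def den_frame)
  moreover have "?d 0 \<in> ?R \<longleftrightarrow> joined (st ''m'' 0) ?s ?d {0, st ''A'' 0, st ''i'' 0, st ''j'' 0}"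
  proof
    assume "?d 0 \<in> ?R"
    then show "joined (st ''m'' 0) ?s ?d {0, st ''A'' 0, st ''i'' 0, st ''j'' 0}"
      using I unfolding joined_def live_def by blast
  next
    assume "joined (st ''m'' 0) ?s ?d {0, st ''A'' 0, st ''i'' 0, st ''j'' 0}"
    then show "?d 0 \<in> ?R"
      using I cl unfolding joined_def live_def by simp
  qed
  ultimately show ?thesis by simp
qed

lemma den_admissible_test:
  fixes st :: state
  defines "s \<equiv> st ''s''" and "d \<equiv> st ''d''" and "m \<equiv> st ''m'' 0"
  assumes V: "finite V" "card V \<le> m" "s 0 \<in> V" "cutset {..<m} s d V = {}"
    and m: "0 < m"
  shows "den admissible_test st ''ok'' 0 = of_bool (\<forall>i<m. \<forall>j<m.
    i \<notin> {st ''B'' 0, st ''C'' 0} \<longrightarrow> j \<notin> {st ''B'' 0, st ''C'' 0} \<longrightarrow> joined m s d {0, st ''A'' 0, i, j})"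
proof -
  let ?P = "\<lambda>i j. i \<notin> {st ''B'' 0, st ''C'' 0} \<longrightarrow> j \<notin> {st ''B'' 0, st ''C'' 0}
    \<longrightarrow> joined m s d {0, st ''A'' 0, i, j}"
  define body where "body =
    When (Conj (Conj (Ne (Var ''i'') (Var ''B'')) (Ne (Var ''i'') (Var ''C'')))
               (Conj (Ne (Var ''j'') (Var ''B'')) (Ne (Var ''j'') (Var ''C''))))
      (reach ;; When (Ne (Elem ''mk'' (Elem ''d'' (Const 0))) (Const 1)) (Set ''ok'' (Const 0)))"
  define st1 where "st1 = put ''ok'' 0 1 st"
  have as: "assigned body = {''e'', ''mk'', ''l'', ''ok''}" by (auto simp: body_def)
  have wf: "well_formed body" by (simp add: body_def)
  have body: "den body t ''ok'' 0 = (if ?P (t ''i'' 0) (t ''j'' 0) then t ''ok'' 0 else 0)"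
    if fr: "\<And>y. y \<notin> {''e'', ''mk'', ''l'', ''ok'', ''i'', ''j''} \<Longrightarrow> t y = st y" for t
  proof -
    have eqs: "t ''s'' = s" "t ''d'' = d" "t ''m'' 0 = m" "t ''A'' = st ''A''" "t ''B'' = st ''B''" "t ''C'' = st ''C''"
      by (simp_all add: fr s_def d_def m_def)
    have "cutset (live t) s d V = {}" using V(4) eqs by (auto simp: cutset_def live_def)
    then have "den reach t ''mk'' (d 0) = 1 \<longleftrightarrow> joined m s d {0, st ''A'' 0, t ''i'' 0, t ''j'' 0}"
      using den_reach[of V t] V m eqs by simp
    then show ?thesis
      using eqs by (auto simp: body_def den_frame)
  qed
  let ?I = "\<lambda>i t. t ''ok'' 0 = (of_bool (\<forall>i'<i. \<forall>j<m. ?P i' j) :: nat)"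
  have "?I (1 * st1 ''m'' 0) (den (For ''i'' 1 (For ''j'' 1 body)) st1)"
  proof (rule For_inv[where I = ?I])
    fix i t
    assume i: "i < 1 * st1 ''m'' 0" "t ''i'' 0 = i"
      and fr: "\<And>y. y \<notin> insert ''i'' (assigned (For ''j'' 1 body)) \<Longrightarrow> t y = st1 y" and I: "?I i t"
    \<comment> \<open>The inner loop can only reset \<open>ok\<close>, so its invariant is relative
      to the value on entry.\<close>
    let ?J = "\<lambda>j r. r ''ok'' 0 = (if \<forall>j'<j. ?P i j' then t ''ok'' 0 else (0 :: nat))"
    have tm: "t ''m'' 0 = m" using fr as by (simp add: st1_def m_def)
    have "?J (1 * t ''m'' 0) (den (For ''j'' 1 body) t)"
    proof (rule For_inv[where I = ?J])
      fix j r
      assume j: "r ''j'' 0 = j" and fr2: "\<And>y. y \<notin> insert ''j'' (assigned body) \<Longrightarrow> r y = t y" and J: "?J j r"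
      have "r y = st y" if "y \<notin> {''e'', ''mk'', ''l'', ''ok'', ''i'', ''j''}" for y
        using that fr fr2 as by (simp add: st1_def put_other)
      moreover have "r ''i'' 0 = i" using fr2 as i by simp
      ultimately show "?J (Suc j) (den body r)"
        using body[of r] j J by (auto simp: less_Suc_eq)
    qed (use as wf in auto)
    then show "?I (Suc i) (den (For ''j'' 1 body) t)"
      using I tm by (auto simp: less_Suc_eq)
  qed (use as wf in \<open>auto simp: st1_def\<close>)
  then show ?thesis
    unfolding admissible_test_def body_def[symmetric] by (simp add: st1_def m_def)
qed


section \<open>Choosing a splitting\<close>

text \<open>The edges found are shifted through \<open>A\<close>, \<open>B\<close>, \<open>C\<close>; there are exactly three of them.\<close>

definition scan :: prog where
  "scan = For ''e'' 1
     (When (Conj (Ne (Var ''e'') (Const 0)) (Conj (Ne (Elem ''s'' (Var ''e'')) (Elem ''d'' (Var ''e'')))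
        (Neg (Conj (Ne (Elem ''s'' (Var ''e'')) (Elem ''d'' (Const 0)))
                   (Ne (Elem ''d'' (Var ''e'')) (Elem ''d'' (Const 0)))))))
      (Set ''C'' (Var ''B'') ;; Set ''B'' (Var ''A'') ;; Set ''A'' (Var ''e'')))"

definition swap :: "string \<Rightarrow> string \<Rightarrow> prog" where
  "swap x y = Set ''tmp'' (Var x) ;; Set x (Var y) ;; Set y (Var ''tmp'')"

text \<open>Signed costs are kept as differences \<open>P[e] - Q[e]\<close>.\<close>

definition cheaper :: "string \<Rightarrow> string \<Rightarrow> bexp" where
  "cheaper x y = Less (Plus (Elem ''P'' (Var x)) (Elem ''Q'' (Var y)))
                      (Plus (Elem ''P'' (Var y)) (Elem ''Q'' (Var x)))"

definition pick :: prog where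
  "pick = scan ;; When (cheaper ''A'' ''B'') (swap ''A'' ''B'') ;;
     When (cheaper ''C'' ''B'') (swap ''C'' ''B'') ;;
     admissible_test ;; When (Ne (Var ''ok'') (Const 1)) (swap ''A'' ''C'')"

definition price :: "state \<Rightarrow> nat \<Rightarrow> int" where
  "price st e = int (st ''P'' e) - int (st ''Q'' e)"

lemma assigned_pick [simp]:
  "assigned scan = {''e'', ''A'', ''B'', ''C''}"
  "assigned (swap x y) = {''tmp'', x, y}"
  "assigned pick = {''e'', ''A'', ''B'', ''C'', ''tmp'', ''mk'', ''l'', ''i'', ''j'', ''ok''}"
  by (auto simp: scan_def swap_def pick_def)

lemma well_formed_pick [simp]:
  "well_formed scan"
  "x \<noteq> ''m'' \<Longrightarrow> y \<noteq> ''m'' \<Longrightarrow> well_formed (swap x y)"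
  "well_formed pick"
  by (simp_all add: scan_def swap_def pick_def)

lemma bval_cheaper [simp]:
  "bval (cheaper x y) st \<longleftrightarrow> price st (st x 0) < price st (st y 0)"
  by (auto simp: cheaper_def price_def)

definition spokes :: "nat \<Rightarrow> (nat \<Rightarrow> nat) \<Rightarrow> (nat \<Rightarrow> nat) \<Rightarrow> nat set" where
  "spokes m s d = {e. e < m \<and> e \<noteq> 0 \<and> (s e = d 0) \<noteq> (d e = d 0)}"

lemma den_scan:
  fixes st :: state
  assumes "card (spokes (st ''m'' 0) (st ''s'') (st ''d'')) = 3"
  shows "spokes (st ''m'' 0) (st ''s'') (st ''d'') =
     {den scan st ''A'' 0, den scan st ''B'' 0, den scan st ''C'' 0}"
proof -
  let ?H = "\<lambda>i. spokes i (st ''s'') (st ''d'')"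
  \<comment> \<open>The registers hold the latest edges found. Nothing is lost up to three finds,
    and each conjunct mentions only the registers filled by then; beyond three nothing is
    claimed.\<close>
  let ?I = "\<lambda>i t. (card (?H i) = 1 \<longrightarrow> ?H i = {t ''A'' (0::nat)}) \<and>
     (card (?H i) = 2 \<longrightarrow> ?H i = {t ''A'' 0, t ''B'' 0}) \<and>
     (card (?H i) = 3 \<longrightarrow> ?H i = {t ''A'' 0, t ''B'' 0, t ''C'' (0::nat)})"
  define body where "body = When (Conj (Ne (Var ''e'') (Const 0)) (Conj (Ne (Elem ''s'' (Var ''e'')) (Elem ''d'' (Var ''e'')))
        (Neg (Conj (Ne (Elem ''s'' (Var ''e'')) (Elem ''d'' (Const 0)))
                   (Ne (Elem ''d'' (Var ''e'')) (Elem ''d'' (Const 0)))))))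
      (Set ''C'' (Var ''B'') ;; Set ''B'' (Var ''A'') ;; Set ''A'' (Var ''e''))"
  have as: "assigned body = {''A'', ''B'', ''C''}" by (auto simp: body_def)
  have wf: "well_formed body" by (simp add: body_def)
  have "?I (1 * st ''m'' 0) (den (For ''e'' 1 body) st)"
  proof (rule For_inv[where I = ?I])
    fix i t
    assume ti: "t ''e'' 0 = i"
      and fr: "\<And>y. y \<notin> insert ''e'' (assigned body) \<Longrightarrow> t y = st y" and I: "?I i t"
    have eqs: "t ''s'' = st ''s''" "t ''d'' = st ''d''" by (simp_all add: fr as)
    have fin: "finite (?H i)" by (simp add: spokes_def)
    have iH: "i \<notin> ?H i" by (simp add: spokes_def)
    let ?hit = "i \<noteq> 0 \<and> st ''s'' i \<noteq> st ''d'' i \<and> (st ''s'' i = st ''d'' 0 \<or> st ''d'' i = st ''d'' 0)"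
    have suc: "?H (Suc i) = (if ?hit then insert i (?H i) else ?H i)"
      by (auto simp: spokes_def less_Suc_eq)
    show "?I (Suc i) (den body t)"
    proof (cases ?hit)
      case True
      have b: "den body t ''A'' 0 = i" "den body t ''B'' 0 = t ''A'' 0" "den body t ''C'' 0 = t ''B'' 0"
        using True ti eqs by (auto simp: body_def)
      have S: "?H (Suc i) = insert i (?H i)" using suc True by simp
      have c: "card (?H (Suc i)) = Suc (card (?H i))" unfolding S using fin iH by simp
      show ?thesis
        unfolding c unfolding S b
      proof (intro conjI impI)
        assume "Suc (card (?H i)) = 1"
        then have "?H i = {}" using fin by simp
        then show "insert i (?H i) = {i}" by (rule arg_cong)
      next
        assume "Suc (card (?H i)) = 2"
        then have "?H i = {t ''A'' 0}" using I by simp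
        then show "insert i (?H i) = {i, t ''A'' 0}" by (rule arg_cong)
      next
        assume "Suc (card (?H i)) = 3"
        then have "?H i = {t ''A'' 0, t ''B'' 0}" using I by simp
        then show "insert i (?H i) = {i, t ''A'' 0, t ''B'' 0}" by (rule arg_cong)
      qed
    next
      case False
      have "den body t = t" using False ti eqs by (auto simp: body_def)
      moreover have "?H (Suc i) = ?H i" unfolding suc using False by (rule if_not_P)
      ultimately show ?thesis using I by simp
    qed
  qed (use as wf in \<open>simp_all add: spokes_def\<close>)
  then show ?thesis
    using assms unfolding scan_def body_def[symmetric] by simp
qed

lemma den_swap:
  assumes "x \<noteq> ''tmp''" "y \<noteq> ''tmp''" "x \<noteq> y"
  shows "den (swap x y) st x 0 = st y 0" "den (swap x y) st y 0 = st x 0"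
    "z \<notin> {x, y, ''tmp''} \<Longrightarrow> den (swap x y) st z = st z"
  using assms by (auto simp: swap_def put_other)

lemma price_cong: "t ''P'' = st ''P'' \<Longrightarrow> t ''Q'' = st ''Q'' \<Longrightarrow> price t = price st"
  by (simp add: price_def fun_eq_iff)

lemma splitting_intro:
  fixes s d :: "nat \<Rightarrow> nat"
  assumes four: "four_graph V {..<m} s d" and "s 0 \<noteq> d 0" "0 < m"
    and sp: "spokes m s d = {A, B, C}"
    and dist: "distinct [A, B, C]"
  shows "splitting V {..<m} s d 0 A B C"
proof
  show "four_graph V {..<m} s d" by fact
  have "cutset {..<m} s d {d 0} = insert 0 (spokes m s d)"
    using assms(2,3) by (auto simp: cutset_def spokes_def)
  then show "cutset {..<m} s d {d 0} = {0, A, B, C}" using sp by simp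
  have "0 \<notin> spokes m s d" by (simp add: spokes_def)
  then show "distinct [0, A, B, C]" using sp dist by simp
qed

text \<open>The cut around \<open>d 0\<close> has at least 4 edges by connectivity and at most 4 by
  valency, and one of them is edge \<open>0\<close>.\<close>

lemma card_spokes:
  fixes s d :: "nat \<Rightarrow> nat"
  assumes four: "four_graph V {..<m} s d" and ne: "s 0 \<noteq> d 0" "0 < m"
  shows "card (spokes m s d) = 3"
proof -
  have V: "s 0 \<in> V" "d 0 \<in> V" using assms by (auto simp: four_graph_def)
  have "4 \<le> card (cutset {..<m} s d {d 0})"
    using four V ne unfolding four_graph_def cuts_ge_def by auto
  moreover have "card (cutset {..<m} s d {d 0}) \<le> valency {..<m} s d (d 0)"
    unfolding valency_def card_cutset[OF finite_lessThan] by (rule sum_mono) simp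
  moreover have "valency {..<m} s d (d 0) = 4" using four V by (simp add: four_graph_def)
  ultimately have "card (cutset {..<m} s d {d 0}) = 4" by simp
  moreover have "cutset {..<m} s d {d 0} = insert 0 (spokes m s d)"
    using ne by (auto simp: cutset_def spokes_def)
  moreover have "0 \<notin> spokes m s d" "finite (spokes m s d)" by (simp_all add: spokes_def)
  ultimately show ?thesis by simp
qed

lemma joined_iff_not_bad:
  assumes "splitting V {..<m} s d 0 A B C"
  shows "(\<forall>i<m. \<forall>j<m. i \<notin> {B, C} \<longrightarrow> j \<notin> {B, C} \<longrightarrow> joined m s d {0, A, i, j})
    \<longleftrightarrow> \<not> splitting.bad V {..<m} s d 0 A B C"
proof -
  interpret splitting V "{..<m}" s d 0 A B C by fact
  show ?thesis
  proof
    assume j: "\<forall>i<m. \<forall>j<m. i \<notin> {B, C} \<longrightarrow> j \<notin> {B, C} \<longrightarrow> joined m s d {0, A, i, j}"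
    show "\<not> bad"
    proof
      assume bad
      then obtain i j S where "i \<in> {..<m} - {B, C}" "j \<in> {..<m} - {B, C}" "s 0 \<in> S" "d 0 \<notin> S"
        "cutset ({..<m} - {0, A, i, j}) s d S = {}" by (rule bad_imp_closed)
      then show False using j unfolding joined_def by auto
    qed
  next
    assume nb: "\<not> bad"
    show "\<forall>i<m. \<forall>j<m. i \<notin> {B, C} \<longrightarrow> j \<notin> {B, C} \<longrightarrow> joined m s d {0, A, i, j}"
      unfolding joined_def
    proof (intro allI impI, rule ccontr)
      fix i j T
      assume T: "i \<notin> {B, C}" "j \<notin> {B, C}" "s 0 \<in> T" "cutset ({..<m} - {0, A, i, j}) s d T = {}" "d 0 \<notin> T"
      \<comment> \<open>\<open>joined\<close> ranges over arbitrary sets, but bad cuts are given by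
        subsets of \<open>V\<close>. Intersecting with \<open>V\<close> keeps the set closed because
        an edge with an end outside \<open>V\<close> is a loop.\<close>
      have "cutset ({..<m} - {0, A, i, j}) s d (T \<inter> V) = {}"
        using T(4) ends_V by (fastforce simp: cutset_def)
      then have bad using T u_ne_v by (intro closed_imp_bad[of i j "T \<inter> V"]) auto
      then show False using nb by simp
    qed
  qed
qed

text \<open>The two comparisons make \<open>B\<close> the cheapest of the three, so a later exchange
  of \<open>A\<close> and \<open>C\<close> cannot spoil the price condition. The exchange happens
  only if the first pairing is bad, and then the second one is not, by
  \<open>bad_swap\<close>.\<close>

lemma den_pick:
  fixes st :: state
  defines "s \<equiv> st ''s''" and "d \<equiv> st ''d''" and "m \<equiv> st ''m'' 0"
  defines "A \<equiv> den pick st ''A'' 0" and "B \<equiv> den pick st ''B'' 0" and "C \<equiv> den pick st ''C'' 0"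
  assumes four: "four_graph V {..<m} s d" and ne: "s 0 \<noteq> d 0" and m: "0 < m" "card V \<le> m"
  shows "splitting V {..<m} s d 0 A B C" "\<not> splitting.bad V {..<m} s d 0 A B C" "price st B \<le> price st A"
proof -
  define t1 where "t1 = den scan st"
  define t2 where "t2 = den (When (cheaper ''A'' ''B'') (swap ''A'' ''B'')) t1"
  define t3 where "t3 = den (When (cheaper ''C'' ''B'') (swap ''C'' ''B'')) t2"
  define t4 where "t4 = den admissible_test t3"
  define t5 where "t5 = den (When (Ne (Var ''ok'') (Const 1)) (swap ''A'' ''C'')) t4"
  have t5: "den pick st = t5"
    by (simp add: pick_def t1_def t2_def t3_def t4_def t5_def)
  have fr1: "t1 y = st y" if "y \<notin> {''e'', ''A'', ''B'', ''C''}" for y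
    unfolding t1_def using that by (simp add: den_frame)
  have fr2: "t2 y = t1 y" if "y \<notin> {''A'', ''B'', ''tmp''}" for y
    unfolding t2_def using that by (intro den_frame) auto
  have fr3: "t3 y = t2 y" if "y \<notin> {''C'', ''B'', ''tmp''}" for y
    unfolding t3_def using that by (intro den_frame) auto
  have fr4: "t4 y = t3 y" if "y \<notin> {''e'', ''mk'', ''l'', ''i'', ''j'', ''ok''}" for y
    unfolding t4_def using that by (intro den_frame) auto
  have p: "price t1 = price st" "price t2 = price st"
    by (rule price_cong; simp add: fr1 fr2)+
  let ?H = "spokes m s d"
  have card: "card ?H = 3" using card_spokes[OF four ne m(1)] .
  have H1: "?H = {t1 ''A'' 0, t1 ''B'' 0, t1 ''C'' 0}"
    using den_scan[of st] card unfolding s_def d_def m_def t1_def by simp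
  have H2: "?H = {t2 ''A'' 0, t2 ''B'' 0, t2 ''C'' 0} \<and> price st (t2 ''B'' 0) \<le> price st (t2 ''A'' 0)"
    using H1 by (auto simp: t2_def den_swap p)
  have H3: "?H = {t3 ''A'' 0, t3 ''B'' 0, t3 ''C'' 0} \<and> price st (t3 ''B'' 0) \<le> price st (t3 ''A'' 0)
      \<and> price st (t3 ''B'' 0) \<le> price st (t3 ''C'' 0)"
    using H2 by (auto simp: t3_def den_swap p)
  have dist3: "distinct [t3 ''A'' 0, t3 ''B'' 0, t3 ''C'' 0]"
    using card H3 by (auto simp: card_insert_if split: if_splits)
  have sp3: "splitting V {..<m} s d 0 (t3 ''A'' 0) (t3 ''B'' 0) (t3 ''C'' 0)"
    using splitting_intro[OF four ne m(1) _ dist3] H3 by simp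
  interpret S: splitting V "{..<m}" s d 0 "t3 ''A'' 0" "t3 ''B'' 0" "t3 ''C'' 0" by (rule sp3)
  have eq3: "t3 ''s'' = s" "t3 ''d'' = d" "t3 ''m'' 0 = m"
    by (simp_all add: fr1 fr2 fr3 s_def d_def m_def)
  have cl: "cutset {..<m} s d V = {}" using S.ends_V unfolding cutset_def by fastforce
  have ok: "t4 ''ok'' 0 = of_bool (\<not> S.bad)"
    unfolding t4_def joined_iff_not_bad[OF sp3, symmetric]
    using den_admissible_test[of V t3] eq3 S.finV m cl S.u_ne_v(2) by simp
  have sw: "splitting V {..<m} s d 0 (t3 ''C'' 0) (t3 ''B'' 0) (t3 ''A'' 0)"
    using splitting_intro[OF four ne m(1)] H3 dist3 by (simp add: insert_commute eq_commute)
  have eq4: "t4 ''A'' = t3 ''A''" "t4 ''B'' = t3 ''B''" "t4 ''C'' = t3 ''C''"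
    by (simp_all add: fr4)
  have "(splitting V {..<m} s d 0 A B C \<and> \<not> splitting.bad V {..<m} s d 0 A B C) \<and> price st B \<le> price st A"
  proof (cases "S.bad")
    case True
    then have "A = t3 ''C'' 0" "B = t3 ''B'' 0" "C = t3 ''A'' 0"
      using ok eq4 unfolding A_def B_def C_def t5 t5_def by (simp_all add: den_swap)
    then show ?thesis using sw H3 S.bad_swap[OF True] by auto
  next
    case False
    then have "A = t3 ''A'' 0" "B = t3 ''B'' 0" "C = t3 ''C'' 0"
      using ok eq4 unfolding A_def B_def C_def t5 t5_def by simp_all
    then show ?thesis using sp3 H3 False by auto
  qed
  then show "splitting V {..<m} s d 0 A B C" "\<not> splitting.bad V {..<m} s d 0 A B C" "price st B \<le> price st A"
    by blast+
qed


section \<open>The sequence of splittings\<close>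

text \<open>As one end is \<open>v\<close>, the far end of an edge is the sum of its ends minus
  \<open>v\<close>. The order matters: \<open>v\<close> is saved before \<open>d[0]\<close> changes,
  and far ends are read before \<open>A\<close> and \<open>B\<close> become loops. The price of
  \<open>C\<close> becomes \<open>(P[C] + Q[A]) - (Q[C] + P[A])\<close>, the difference of the
  prices of \<open>C\<close> and \<open>A\<close>.\<close>

definition update :: prog where
  "update =
     Asg ''stA'' (Var ''top'') (Var ''A'') ;;
     Asg ''stB'' (Var ''top'') (Var ''B'') ;;
     Asg ''stC'' (Var ''top'') (Var ''C'') ;;
     Set ''top'' (Plus (Var ''top'') (Const 1)) ;;
     Set ''v'' (Elem ''d'' (Const 0)) ;;
     Asg ''d'' (Var ''C'') (Minus (Plus (Elem ''s'' (Var ''C'')) (Elem ''d'' (Var ''C''))) (Var ''v'')) ;;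
     Asg ''s'' (Var ''C'') (Minus (Plus (Elem ''s'' (Var ''B'')) (Elem ''d'' (Var ''B''))) (Var ''v'')) ;;
     Set ''d'' (Minus (Plus (Elem ''s'' (Var ''A'')) (Elem ''d'' (Var ''A''))) (Var ''v'')) ;;
     Asg ''s'' (Var ''A'') (Var ''v'') ;;
     Asg ''d'' (Var ''A'') (Var ''v'') ;;
     Asg ''s'' (Var ''B'') (Var ''v'') ;;
     Asg ''d'' (Var ''B'') (Var ''v'') ;;
     Asg ''P'' (Var ''C'') (Plus (Elem ''P'' (Var ''C'')) (Elem ''Q'' (Var ''A''))) ;;
     Asg ''Q'' (Var ''C'') (Plus (Elem ''Q'' (Var ''C'')) (Elem ''P'' (Var ''A''))) ;;
     Asg ''P'' (Var ''A'') (Const 0) ;;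
     Asg ''Q'' (Var ''A'') (Const 0) ;;
     Asg ''P'' (Var ''B'') (Const 0) ;;
     Asg ''Q'' (Var ''B'') (Const 0)"

definition forward :: prog where
  "forward = For ''q'' 1 (When (Ne (Elem ''s'' (Const 0)) (Elem ''d'' (Const 0))) (pick ;; update))"

lemma assigned_update [simp]:
  "assigned update = {''stA'', ''stB'', ''stC'', ''top'', ''v'', ''s'', ''d'', ''P'', ''Q''}"
  by (simp add: update_def insert_commute)

lemma assigned_forward [simp]: "assigned forward = insert ''q'' (assigned pick \<union> assigned update)"
  by (simp add: forward_def del: assigned_pick assigned_update)

lemma well_formed_forward [simp]: "well_formed update" "well_formed forward"
proof -
  show 1: "well_formed update" by (simp add: update_def)
  show "well_formed forward" by (simp add: forward_def 1)
qed

lemma den_update: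
  fixes st :: state
  defines "A \<equiv> st ''A'' 0" and "B \<equiv> st ''B'' 0" and "C \<equiv> st ''C'' 0"
  assumes "splitting V {..<m} (st ''s'') (st ''d'') 0 A B C"
  shows "den update st ''s'' = splitting.s' (st ''s'') (st ''d'') 0 A B C"
    and "den update st ''d'' = splitting.d' (st ''s'') (st ''d'') 0 A B C"
    and "price (den update st) = splitting.c' A B C (price st)"
    and "den update st ''stA'' = (st ''stA'')(st ''top'' 0 := A)"
    and "den update st ''stB'' = (st ''stB'')(st ''top'' 0 := B)"
    and "den update st ''stC'' = (st ''stC'')(st ''top'' 0 := C)"
    and "den update st ''top'' 0 = Suc (st ''top'' 0)"
proof -
  interpret splitting V "{..<m}" "st ''s''" "st ''d''" 0 A B C by fact
  have o: "oth x = st ''s'' x + st ''d'' x - st ''d'' 0" if "x \<in> {0, A, B, C}" for x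
    using star_ends[OF that] by auto
  have ne: "A \<noteq> 0" "B \<noteq> 0" "C \<noteq> 0" "A \<noteq> B" "A \<noteq> C" "B \<noteq> C" "B \<noteq> A" "C \<noteq> A" "C \<noteq> B"
    using dist by auto
  show "den update st ''s'' = s'"
    using ne unfolding s'_def o[of B, simplified] unfolding fun_eq_iff update_def A_def B_def C_def by simp
  show "den update st ''d'' = d'"
    using ne unfolding d'_def o[of A, simplified] o[of C, simplified]
    unfolding fun_eq_iff update_def A_def B_def C_def by simp
  show "price (den update st) = c' (price st)"
    using ne unfolding c'_def unfolding fun_eq_iff price_def update_def A_def B_def C_def by simp
  show "den update st ''stA'' = (st ''stA'')(st ''top'' 0 := A)"
    "den update st ''stB'' = (st ''stB'')(st ''top'' 0 := B)"
    "den update st ''stC'' = (st ''stC'')(st ''top'' 0 := C)"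
    "den update st ''top'' 0 = Suc (st ''top'' 0)"
    using ne unfolding fun_eq_iff update_def A_def B_def C_def by simp_all
qed

section \<open>Cheap 2-edge-connected sets and the one-vertex base case\<close>

definition cheap_2ec :: "'v set \<Rightarrow> 'e set \<Rightarrow> ('e \<Rightarrow> 'v) \<Rightarrow> ('e \<Rightarrow> 'v) \<Rightarrow> 'e \<Rightarrow> ('e \<Rightarrow> int) \<Rightarrow> 'e set \<Rightarrow> bool" where
  "cheap_2ec V E s d z c F \<longleftrightarrow>
     F \<subseteq> E - {z} \<and> cuts_ge 2 V F s d \<and> 3 * sum c F \<le> 2 * sum c (E - {z})"

lemma (in splitting) cheap_2ec_lift:
  assumes "c B \<le> c A" "cheap_2ec (V - {v}) E s' d' z (c' c) F"
  shows "cheap_2ec V E s d z c (lift F)"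
  using assms lift_sub lift_cuts lift_cost unfolding cheap_2ec_def by blast

text \<open>A loop adds 2 to the valency of its vertex and nothing to the cut around it, so a second
  vertex would force valency at least 6. Hence splitting stops only when a single vertex is
  left.\<close>

lemma four_graph_loop:
  assumes "four_graph V E s d" "z \<in> E" "s z = d z" "s z \<in> V"
  shows "V = {s z}"
proof (rule ccontr)
  assume ne: "V \<noteq> {s z}"
  have fin: "finite E" using assms(1) by (simp add: four_graph_def)
  have "4 \<le> card (cutset E s d {s z})"
    using assms ne unfolding four_graph_def cuts_ge_def by auto
  moreover have "card (cutset E s d {s z}) + 2 \<le> valency E s d (s z)"
  proof -
    let ?f = "\<lambda>e. of_bool (s e = s z) + of_bool (d e = s z) :: nat"
    have "valency E s d (s z) = ?f z + (\<Sum>e\<in>E - {z}. ?f e)"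
      using fin assms(2) unfolding valency_def by (rule sum.remove)
    moreover have "card (cutset E s d {s z}) = (\<Sum>e\<in>E - {z}. of_bool ((s e \<in> {s z}) \<noteq> (d e \<in> {s z})))"
      unfolding card_cutset[OF fin] sum.remove[OF fin assms(2)] using assms(3) by simp
    moreover have "\<dots> \<le> (\<Sum>e\<in>E - {z}. ?f e)"
      by (rule sum_mono) simp
    moreover have "?f z = 2" using assms(3) by simp
    ultimately show ?thesis by simp
  qed
  moreover have "valency E s d (s z) = 4" using assms by (simp add: four_graph_def)
  ultimately show False by simp
qed

text \<open>One vertex has no proper side, so every edge set qualifies and exactly the edges of
  negative cost are taken. The bound holds termwise: \<open>3 * c e \<le> 2 * c e\<close> if
  \<open>c e < 0\<close>, and \<open>0 \<le> 2 * c e\<close> otherwise. The condition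
  \<open>c z = 0\<close> keeps \<open>z\<close> out.\<close>

lemma cheap_2ec_singleton:
  assumes "finite E" "c z = 0"
  shows "cheap_2ec {u} E s d z c {e\<in>E. c e < 0}"
proof -
  have "3 * sum c {e\<in>E. c e < 0} = (\<Sum>e\<in>E - {z}. 3 * (if c e < 0 then c e else 0))"
  proof -
    have "{e\<in>E. c e < 0} = {e\<in>E - {z}. c e < 0}" using assms(2) by auto
    then have "sum c {e\<in>E. c e < 0} = (\<Sum>e\<in>E - {z}. if c e < 0 then c e else 0)"
      using assms(1) by (simp only: sum.inter_filter finite_Diff)
    then show ?thesis by (simp only: sum_distrib_left)
  qed
  also have "\<dots> \<le> (\<Sum>e\<in>E - {z}. 2 * c e)" by (rule sum_mono) auto
  finally show ?thesis
    using assms(2) unfolding cheap_2ec_def cuts_ge_def by (auto simp: sum_distrib_left)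
qed

text \<open>Entry \<open>k\<close> of the stack records splitting number \<open>k\<close>, counted
  from 0; the latest splitting is lifted first.\<close>

primrec unwound :: "(nat \<Rightarrow> 'e) \<Rightarrow> (nat \<Rightarrow> 'e) \<Rightarrow> (nat \<Rightarrow> 'e) \<Rightarrow> nat \<Rightarrow> 'e set \<Rightarrow> 'e set" where
  "unwound a b c 0 F = F"
| "unwound a b c (Suc k) F = unwound a b c k (lift_split (a k) (b k) (c k) F)"

lemma unwound_fun_upd: "k \<le> i \<Longrightarrow> unwound (a(i := x)) (b(i := y)) (c(i := z)) k F = unwound a b c k F"
  by (induction k arbitrary: F) auto

definition stack_ok :: "state \<Rightarrow> bool" where
  "stack_ok st \<longleftrightarrow> (\<forall>k<st ''top'' 0. {st ''stA'' k, st ''stB'' k, st ''stC'' k} \<subseteq> edges st \<and>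
     distinct [st ''stA'' k, st ''stB'' k, st ''stC'' k])"

lemma den_forward:
  fixes st :: state
  defines "s \<equiv> st ''s''" and "d \<equiv> st ''d''" and "m \<equiv> st ''m'' 0"
  assumes V: "four_graph V {..<m} s d" "card V \<le> m" "s 0 \<in> V"
    and m: "0 < m" and top: "st ''top'' 0 = 0" and p0: "price st 0 = 0"
  defines "r \<equiv> den forward st"
  shows "cheap_2ec V {..<m} s d 0 (price st)
           (unwound (r ''stA'') (r ''stB'') (r ''stC'') (r ''top'' 0) {e\<in>{..<m}. price r e < 0})"
    and "stack_ok r" and "r ''top'' 0 \<le> m" and "price r 0 = 0"
proof -
  let ?E = "{..<m}"
  \<comment> \<open>The last clause is a promise: any cheap set of the current graph on
    \<open>W\<close> unwinds to a cheap set of the original graph. While edge \<open>0\<close> is no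
    loop, each round removes a vertex, which \<open>card W + q \<le> m\<close> records.\<close>
  let ?J = "\<lambda>q t W. four_graph W ?E (t ''s'') (t ''d'') \<and> card W \<le> m \<and> t ''s'' 0 \<in> W
     \<and> (t ''s'' 0 = t ''d'' 0 \<or> card W + q \<le> m) \<and> price t 0 = 0 \<and> t ''top'' 0 \<le> q \<and> stack_ok t
     \<and> (\<forall>F. cheap_2ec W ?E (t ''s'') (t ''d'') 0 (price t) F \<longrightarrow>
          cheap_2ec V ?E s d 0 (price st) (unwound (t ''stA'') (t ''stB'') (t ''stC'') (t ''top'' 0) F))"
  let ?I = "\<lambda>q t. \<exists>W. ?J q t W"
  define body where "body = When (Ne (Elem ''s'' (Const 0)) (Elem ''d'' (Const 0))) (pick ;; update)"
  have as: "''q'' \<notin> assigned body" "''m'' \<notin> assigned body" by (simp_all add: body_def)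
  have wf: "well_formed body" by (simp add: body_def)
  have "?I (1 * st ''m'' 0) (den (For ''q'' 1 body) st)"
  proof (rule For_inv[where I = ?I])
    fix q t
    assume fr: "\<And>y. y \<notin> insert ''q'' (assigned body) \<Longrightarrow> t y = st y" and I: "?I q t"
    have tm: "t ''m'' 0 = m" using fr as by (simp add: m_def)
    obtain W where W: "?J q t W" using I by blast
    show "?I (Suc q) (den body t)"
    proof (cases "t ''s'' 0 = t ''d'' 0")
      case True
      then have "den body t = t" by (simp add: body_def)
      then show ?thesis using W True by (intro exI[of _ W]) simp
    next
      case False
      define t' where "t' = den pick t"
      let ?A = "t' ''A'' 0" and ?B = "t' ''B'' 0" and ?C = "t' ''C'' 0"
      have fr': "t' y = t y" if "y \<notin> assigned pick" for y
        using that unfolding t'_def by (rule den_frame)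
      have eqs: "t' ''s'' = t ''s''" "t' ''d'' = t ''d''" "t' ''top'' = t ''top''" "t' ''stA'' = t ''stA''"
        "t' ''stB'' = t ''stB''" "t' ''stC'' = t ''stC''" "t' ''m'' 0 = m"
        using tm by (simp_all add: fr')
      have pr: "price t' = price t" by (rule price_cong; simp add: fr')
      have pk: "splitting W ?E (t ''s'') (t ''d'') 0 ?A ?B ?C"
        "\<not> splitting.bad W ?E (t ''s'') (t ''d'') 0 ?A ?B ?C"
        "price t ?B \<le> price t ?A"
        using den_pick[of W t] W False m tm unfolding t'_def by simp_all
      interpret S: splitting W ?E "t ''s''" "t ''d''" 0 ?A ?B ?C by (rule pk(1))
      have b: "den body t = den update t'" using False by (simp add: body_def t'_def)
      note up = den_update[of W m t', unfolded eqs pr, OF pk(1)]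
      have um: "den update t' ''m'' 0 = m" by (simp add: den_frame eqs)
      have ok: "stack_ok (den update t')"
        using W S.star_in S.dist tm unfolding stack_ok_def up um by (auto simp: less_Suc_eq)
      have cheap: "cheap_2ec V ?E s d 0 (price st) (unwound ((t ''stA'')(t ''top'' 0 := ?A))
          ((t ''stB'')(t ''top'' 0 := ?B)) ((t ''stC'')(t ''top'' 0 := ?C)) (Suc (t ''top'' 0)) F)"
        if "cheap_2ec (W - {t ''d'' 0}) ?E S.s' S.d' 0 (S.c' (price t)) F" for F
      proof -
        have "cheap_2ec W ?E (t ''s'') (t ''d'') 0 (price t) (S.lift F)"
          using pk(3) that by (rule S.cheap_2ec_lift)
        then show ?thesis using W by (simp add: unwound_fun_upd)
      qed
      have "?J (Suc q) (den update t') (W - {t ''d'' 0})"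
      proof (intro conjI)
        show "four_graph (W - {t ''d'' 0}) ?E (den update t' ''s'') (den update t' ''d'')"
          unfolding up by (rule S.four_graph_split[OF pk(2)])
        have cd: "Suc (card (W - {t ''d'' 0})) = card W"
          using S.finV S.u_ne_v(3) by (rule card_Suc_Diff1)
        show "card (W - {t ''d'' 0}) \<le> m" using cd W by simp
        show "den update t' ''s'' 0 = den update t' ''d'' 0 \<or> card (W - {t ''d'' 0}) + Suc q \<le> m"
          using cd W False by simp
        show "den update t' ''s'' 0 \<in> W - {t ''d'' 0}"
          unfolding up using S.new_ends(1) S.u_ne_v by simp
        show "price (den update t') 0 = 0"
          unfolding up S.c'_def using W S.dist by simp
        show "den update t' ''top'' 0 \<le> Suc q" unfolding up using W by simp
        show "stack_ok (den update t')" by (rule ok)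
        show "\<forall>F. cheap_2ec (W - {t ''d'' 0}) ?E (den update t' ''s'') (den update t' ''d'') 0
            (price (den update t')) F \<longrightarrow> cheap_2ec V ?E s d 0 (price st) (unwound (den update t' ''stA'')
            (den update t' ''stB'') (den update t' ''stC'') (den update t' ''top'' 0) F)"
          unfolding up using cheap by blast
      qed
      then show ?thesis unfolding b by blast
    qed
  next
    show "?I 0 st"
      using V top p0 by (intro exI[of _ V]) (simp add: s_def d_def stack_ok_def)
  next
    show "?I i (put ''q'' 0 j t) = ?I i t" for i j t
      by (simp add: price_def[abs_def] stack_ok_def put_other)
  qed (use as wf in simp_all)
  then have "?I m r" unfolding r_def forward_def body_def[symmetric] by (simp add: m_def)
  then obtain W where W: "?J m r W" by blast
  have "finite W" using W by (simp add: four_graph_def)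
  then have "card W \<noteq> 0" using W by auto
  \<comment> \<open>At \<open>q = m\<close> the other alternative would force
    \<open>card W = 0\<close>.\<close>
  then have loop: "r ''s'' 0 = r ''d'' 0" using W by linarith
  then have "W = {r ''s'' 0}" using W m by (intro four_graph_loop[of W ?E _ "r ''d''"]) auto
  then show "cheap_2ec V {..<m} s d 0 (price st)
           (unwound (r ''stA'') (r ''stB'') (r ''stC'') (r ''top'' 0) {e\<in>{..<m}. price r e < 0})"
    using W cheap_2ec_singleton[of ?E "price r" 0 "r ''s'' 0" "r ''s''" "r ''d''"] by simp
  show "stack_ok r" "r ''top'' 0 \<le> m" "price r 0 = 0" using W by simp_all
qed


section \<open>One round\<close>

lemma cutset_cong:
  "(\<And>e. e \<in> E \<Longrightarrow> s e = s' e \<and> d e = d' e) \<Longrightarrow> cutset E s d S = cutset E s' d' S"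
  by (auto simp: cutset_def)

lemma cuts_ge_cong:
  "(\<And>e. e \<in> E \<Longrightarrow> s e = s' e \<and> d e = d' e) \<Longrightarrow> cuts_ge k V E s d = cuts_ge k V E s' d'"
  by (simp add: cuts_ge_def cutset_cong[of E s s' d d'])

lemma four_graph_cong:
  assumes "\<And>e. e \<in> E \<Longrightarrow> s e = s' e \<and> d e = d' e"
  shows "four_graph V E s d = four_graph V E s' d'"
proof -
  have "valency E s d w = valency E s' d' w" for w
    unfolding valency_def by (rule sum.cong) (simp_all add: assms)
  moreover have "cuts_ge 4 V E s d = cuts_ge 4 V E s' d'" by (rule cuts_ge_cong) (rule assms)
  ultimately show ?thesis using assms by (simp add: four_graph_def)
qed

lemma cheap_2ec_cong:
  assumes "\<And>e. e \<in> E \<Longrightarrow> s e = s' e \<and> d e = d' e" "\<And>e. e \<in> E - {z} \<Longrightarrow> c e = c' e"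
  shows "cheap_2ec V E s d z c F = cheap_2ec V E s' d' z c' F"
proof (cases "F \<subseteq> E - {z}")
  case True
  have "cuts_ge 2 V F s d = cuts_ge 2 V F s' d'" by (rule cuts_ge_cong) (use True assms(1) in auto)
  moreover have "sum c F = sum c' F" by (rule sum.cong) (use True assms(2) in auto)
  moreover have "sum c (E - {z}) = sum c' (E - {z})" by (rule sum.cong) (use assms(2) in auto)
  ultimately show ?thesis by (simp add: cheap_2ec_def)
qed (simp add: cheap_2ec_def)

text \<open>The costs are the excesses \<open>3 * N e - 2 * r\<close>, kept as differences because
  the machine has no negative numbers. Edge \<open>0\<close> plays the role of \<open>z\<close> and
  gets cost 0.\<close>

definition init :: prog where
  "init = For ''e'' 1
     (Asg ''s'' (Var ''e'') (Elem ''src'' (Var ''e'')) ;;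
      Asg ''d'' (Var ''e'') (Elem ''dst'' (Var ''e'')) ;;
      Asg ''P'' (Var ''e'') (Plus (Elem ''N'' (Var ''e'')) (Plus (Elem ''N'' (Var ''e'')) (Elem ''N'' (Var ''e'')))) ;;
      Asg ''Q'' (Var ''e'') (Plus (Var ''r'') (Var ''r''))) ;;
     Set ''P'' (Const 0) ;; Set ''Q'' (Const 0) ;; Set ''top'' (Const 0)"

text \<open>\<open>bs\<close> is the offset of the current block of \<open>chi\<close>. The block
  starts as the solution for the one-vertex graph, the set of edges of negative price.\<close>

definition start :: prog where
  "start = For ''e'' 1
     (Asg ''chi'' (Plus (Var ''bs'') (Var ''e'')) (Const 0) ;;
      When (Less (Elem ''P'' (Var ''e'')) (Elem ''Q'' (Var ''e'')))
        (Asg ''chi'' (Plus (Var ''bs'') (Var ''e'')) (Const 1)))"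

text \<open>\<open>lift_split\<close> on bits: \<open>B\<close> is set, and \<open>A\<close>
  receives the complement of \<open>C\<close>.\<close>

definition unwind :: prog where
  "unwind = For ''q'' 1 (When (Less (Const 0) (Var ''top''))
     (Set ''top'' (Minus (Var ''top'') (Const 1)) ;;
      Asg ''chi'' (Plus (Var ''bs'') (Elem ''stB'' (Var ''top''))) (Const 1) ;;
      Asg ''chi'' (Plus (Var ''bs'') (Elem ''stA'' (Var ''top'')))
        (Minus (Const 1) (Elem ''chi'' (Plus (Var ''bs'') (Elem ''stC'' (Var ''top'')))))))"

definition tally :: prog where
  "tally = For ''e'' 1 (Asg ''N'' (Var ''e'')
     (Plus (Elem ''N'' (Var ''e'')) (Elem ''chi'' (Plus (Var ''bs'') (Var ''e'')))))"

definition round_prog :: prog where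
  "round_prog = init ;; forward ;; start ;; unwind ;; tally ;;
     Asg ''num'' (Var ''r'') (Const 1) ;; Set ''bs'' (Plus (Var ''bs'') (Var ''m''))"

definition program :: prog where
  "program = For ''r'' 64 round_prog ;; Set ''k'' (times_m 64) ;; Set ''den'' (times_m 64)"

lemma assigned_round [simp]:
  "assigned init = {''e'', ''s'', ''d'', ''P'', ''Q'', ''top''}"
  "assigned start = {''e'', ''chi''}"
  "assigned unwind = {''q'', ''top'', ''chi''}"
  "assigned tally = {''e'', ''N''}"
  by (auto simp: init_def start_def unwind_def tally_def)

lemma round_frame: "y \<in> {''m'', ''src'', ''dst'', ''r'', ''n''} \<Longrightarrow> y \<notin> assigned round_prog"
  by (auto simp: round_prog_def)

lemma well_formed_round [simp]:
  "well_formed init" "well_formed start" "well_formed unwind" "well_formed tally"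
  "well_formed round_prog" "well_formed program"
proof -
  show 1: "well_formed init" "well_formed start" "well_formed unwind" "well_formed tally"
    by (simp_all add: init_def start_def unwind_def tally_def)
  show 2: "well_formed round_prog" unfolding round_prog_def using 1 by simp
  show "well_formed program" unfolding program_def using 2 round_frame by simp
qed

lemma den_init:
  assumes "e < st ''m'' 0"
  shows "den init st ''s'' e = st ''src'' e"
    and "den init st ''d'' e = st ''dst'' e"
    and "price (den init st) e = (if e = 0 then 0 else 3 * int (st ''N'' e) - 2 * int (st ''r'' 0))"
    and "den init st ''top'' 0 = 0"
proof -
  define body where "body =
     Asg ''s'' (Var ''e'') (Elem ''src'' (Var ''e'')) ;;
      Asg ''d'' (Var ''e'') (Elem ''dst'' (Var ''e'')) ;;
      Asg ''P'' (Var ''e'') (Plus (Elem ''N'' (Var ''e'')) (Plus (Elem ''N'' (Var ''e'')) (Elem ''N'' (Var ''e'')))) ;;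
      Asg ''Q'' (Var ''e'') (Plus (Var ''r'') (Var ''r''))"
  let ?t = "den (For ''e'' 1 body) st"
  let ?I = "\<lambda>i t. \<forall>e<i. t ''s'' e = st ''src'' e \<and> t ''d'' e = st ''dst'' e \<and>
     t ''P'' e = 3 * st ''N'' e \<and> t ''Q'' e = 2 * st ''r'' (0::nat)"
  have I: "?I (1 * st ''m'' 0) ?t"
  proof (rule For_inv[where I = ?I])
    fix i t
    assume ti: "t ''e'' 0 = i" and fr: "\<And>y. y \<notin> insert ''e'' (assigned body) \<Longrightarrow> t y = st y"
      and I: "?I i t"
    have "t ''src'' = st ''src''" "t ''dst'' = st ''dst''" "t ''N'' = st ''N''" "t ''r'' = st ''r''"
      by (simp_all add: fr body_def)
    then show "?I (Suc i) (den body t)" using I ti by (simp add: body_def less_Suc_eq)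
  qed (simp_all add: body_def)
  have t: "den init st = put ''top'' 0 0 (put ''Q'' 0 0 (put ''P'' 0 0 ?t))"
    by (simp add: init_def body_def)
  show "den init st ''s'' e = st ''src'' e" "den init st ''d'' e = st ''dst'' e"
    "den init st ''top'' 0 = 0"
    unfolding t using I assms by simp_all
  show "price (den init st) e = (if e = 0 then 0 else 3 * int (st ''N'' e) - 2 * int (st ''r'' 0))"
    unfolding t price_def using I assms by simp
qed

definition block :: "state \<Rightarrow> nat set" where
  "block st = {e \<in> edges st. st ''chi'' (st ''bs'' 0 + e) = 1}"

definition bits :: "state \<Rightarrow> bool" where
  "bits st \<longleftrightarrow> (\<forall>e < st ''m'' 0. st ''chi'' (st ''bs'' 0 + e) \<le> 1)"

lemma den_start:
  fixes st :: state
  defines "r \<equiv> den start st"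
  shows "block r = {e \<in> edges st. price st e < 0}" and "bits r"
    and "i < st ''bs'' 0 \<Longrightarrow> r ''chi'' i = st ''chi'' i"
proof -
  define body where "body =
     Asg ''chi'' (Plus (Var ''bs'') (Var ''e'')) (Const 0) ;;
      When (Less (Elem ''P'' (Var ''e'')) (Elem ''Q'' (Var ''e'')))
        (Asg ''chi'' (Plus (Var ''bs'') (Var ''e'')) (Const 1))"
  let ?I = "\<lambda>i t. (\<forall>e<i. t ''chi'' (st ''bs'' 0 + e) = (of_bool (price st e < 0) :: nat)) \<and>
     (\<forall>j<st ''bs'' 0. t ''chi'' j = st ''chi'' j)"
  have I: "?I (1 * st ''m'' 0) r"
    unfolding r_def start_def body_def[symmetric]
  proof (rule For_inv[where I = ?I])
    fix i t
    assume ti: "t ''e'' 0 = i" and fr: "\<And>y. y \<notin> insert ''e'' (assigned body) \<Longrightarrow> t y = st y"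
      and I: "?I i t"
    have "t ''P'' = st ''P''" "t ''Q'' = st ''Q''" "t ''bs'' = st ''bs''"
      by (simp_all add: fr body_def)
    then show "?I (Suc i) (den body t)" using I ti by (simp add: body_def less_Suc_eq price_def)
  qed (simp_all add: body_def)
  have fr: "r ''m'' = st ''m''" "r ''bs'' = st ''bs''" unfolding r_def by (simp_all add: den_frame)
  show "block r = {e \<in> edges st. price st e < 0}" using I unfolding block_def fr by (auto simp: of_bool_def split: if_splits)
  show "bits r" using I unfolding bits_def fr by auto
  show "i < st ''bs'' 0 \<Longrightarrow> r ''chi'' i = st ''chi'' i" using I by simp
qed

text \<open>\<open>bits\<close> makes the truncated difference from 1 a true complement. The last
  claim protects the sets of earlier rounds, which are stored below the current block.\<close>

lemma den_unwind:
  fixes st :: state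
  defines "r \<equiv> den unwind st"
  assumes ok: "stack_ok st" and top: "st ''top'' 0 \<le> st ''m'' 0" and bits: "bits st"
  shows "block r = unwound (st ''stA'') (st ''stB'') (st ''stC'') (st ''top'' 0) (block st)"
    and "bits r"
    and "i < st ''bs'' 0 \<Longrightarrow> r ''chi'' i = st ''chi'' i"
proof -
  define act where "act =
     Set ''top'' (Minus (Var ''top'') (Const 1)) ;;
      Asg ''chi'' (Plus (Var ''bs'') (Elem ''stB'' (Var ''top''))) (Const 1) ;;
      Asg ''chi'' (Plus (Var ''bs'') (Elem ''stA'' (Var ''top'')))
        (Minus (Const 1) (Elem ''chi'' (Plus (Var ''bs'') (Elem ''stC'' (Var ''top'')))))"
  define body where "body = When (Less (Const 0) (Var ''top'')) act"
  have as: "assigned body = {''chi'', ''top''}" by (simp add: body_def act_def)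
  let ?bs = "st ''bs'' 0" and ?m = "st ''m'' 0"
  let ?b = "\<lambda>t. {e \<in> edges st. t ''chi'' (?bs + e) = (1::nat)}"
  let ?un = "unwound (st ''stA'') (st ''stB'') (st ''stC'')"
  \<comment> \<open>Unwinding the present block from the present depth always gives the same set; at
    depth 0 this set is the block itself.\<close>
  let ?I = "\<lambda>q t. t ''top'' 0 = st ''top'' 0 - q \<and> ?un (t ''top'' 0) (?b t) = ?un (st ''top'' 0) (block st)
    \<and> (\<forall>e<?m. t ''chi'' (?bs + e) \<le> (1::nat)) \<and> (\<forall>j<?bs. t ''chi'' j = st ''chi'' j)"
  have "?I (1 * st ''m'' 0) (den (For ''q'' 1 body) st)"
  proof (rule For_inv[where I = ?I])
    fix q t
    assume fr: "\<And>y. y \<notin> insert ''q'' (assigned body) \<Longrightarrow> t y = st y" and I: "?I q t"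
    have eqs: "t ''bs'' = st ''bs''" "t ''stA'' = st ''stA''" "t ''stB'' = st ''stB''" "t ''stC'' = st ''stC''"
      by (simp_all add: fr as)
    show "?I (Suc q) (den body t)"
    proof (cases "t ''top'' 0")
      case 0
      then have "den body t = t" by (simp add: body_def)
      then show ?thesis using I 0 by simp
    next
      case (Suc k)
      let ?A = "st ''stA'' k" and ?B = "st ''stB'' k" and ?C = "st ''stC'' k"
      have "t ''top'' 0 = st ''top'' 0 - q" using I by simp
      then have "k < st ''top'' 0" using Suc by linarith
      then have abc: "?A < ?m" "?B < ?m" "?C < ?m" and ne: "?A \<noteq> ?B" "?A \<noteq> ?C" "?B \<noteq> ?C"
        using ok by (auto simp: stack_ok_def)
      have b: "den body t = den act t" using Suc by (simp add: body_def)
      have chi: "den act t ''chi'' (?bs + e) = (if e = ?A then 1 - t ''chi'' (?bs + ?C) else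
          if e = ?B then 1 else t ''chi'' (?bs + e))" for e
        using Suc ne eqs by (simp add: act_def)
      have lt: "den act t ''chi'' j = t ''chi'' j" if "j < ?bs" for j
        using that Suc eqs by (simp add: act_def)
      have tp: "den act t ''top'' 0 = k" using Suc by (simp add: act_def)
      have "t ''chi'' (?bs + ?C) \<le> 1" using I abc by simp
      then have "?b (den act t) = lift_split ?A ?B ?C (?b t)"
        unfolding chi lift_split_def using abc ne by auto
      then have "?un (Suc k) (?b t) = ?un k (?b (den act t))" by simp
      then have "?un (den act t ''top'' 0) (?b (den act t)) = ?un (st ''top'' 0) (block st)"
        using I Suc tp by simp
      moreover have "den act t ''top'' 0 = st ''top'' 0 - Suc q"
        using \<open>t ''top'' 0 = st ''top'' 0 - q\<close> Suc tp by linarith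
      moreover have "\<forall>e<?m. den act t ''chi'' (?bs + e) \<le> 1" unfolding chi using I by simp
      moreover have "\<forall>j<?bs. den act t ''chi'' j = st ''chi'' j" using lt I by simp
      ultimately show ?thesis unfolding b by blast
    qed
  next
    show "?I 0 st" using bits by (simp add: block_def bits_def)
  qed (simp_all add: body_def act_def)
  then have I: "?I (st ''m'' 0) r" unfolding r_def unwind_def body_def act_def mult_1 .
  have fr: "r ''m'' = st ''m''" "r ''bs'' = st ''bs''" unfolding r_def by (simp_all add: den_frame)
  have top0: "r ''top'' 0 = 0" using I top by simp
  have "?un (r ''top'' 0) (?b r) = ?un (st ''top'' 0) (block st)" using I by (elim conjE)
  then show "block r = ?un (st ''top'' 0) (block st)" unfolding top0 block_def[of r] fr by simp
  show "bits r" using I unfolding bits_def fr by simp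
  show "i < ?bs \<Longrightarrow> r ''chi'' i = st ''chi'' i" using I by simp
qed

lemma den_tally:
  assumes "e < st ''m'' 0"
  shows "den tally st ''N'' e = st ''N'' e + st ''chi'' (st ''bs'' 0 + e)"
proof -
  let ?I = "\<lambda>i t. \<forall>e. t ''N'' e = st ''N'' e + (if e < i then st ''chi'' (st ''bs'' 0 + e) else 0)"
  have "?I (1 * st ''m'' 0) (den tally st)"
    unfolding tally_def by (rule For_inv[where I = ?I]) (auto simp: less_Suc_eq)
  then show ?thesis using assms by simp
qed

lemma den_round:
  fixes st :: state
  defines "u \<equiv> den round_prog st" and "m \<equiv> st ''m'' 0" and "bs \<equiv> st ''bs'' 0"
  defines "x \<equiv> \<lambda>e. if e = 0 then 0 else 3 * int (st ''N'' e) - 2 * int (st ''r'' 0)"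
  assumes V: "four_graph V {..<m} (st ''src'') (st ''dst'')" "card V \<le> m" "st ''src'' 0 \<in> V" and m: "0 < m"
  defines "F \<equiv> {e \<in> {..<m}. u ''chi'' (bs + e) = 1}"
  shows "cheap_2ec V {..<m} (st ''src'') (st ''dst'') 0 x F"
    and "e < m \<Longrightarrow> u ''N'' e = st ''N'' e + of_bool (e \<in> F)"
    and "i < bs \<Longrightarrow> u ''chi'' i = st ''chi'' i"
    and "u ''bs'' 0 = bs + m"
    and "u ''num'' = (st ''num'')(st ''r'' 0 := 1)"
proof -
  define t1 where "t1 = den init st"
  define t2 where "t2 = den forward t1"
  define t3 where "t3 = den start t2"
  define t4 where "t4 = den unwind t3"
  define t5 where "t5 = den tally t4"
  have u: "u = put ''bs'' 0 (t5 ''bs'' 0 + t5 ''m'' 0) (put ''num'' (t5 ''r'' 0) 1 t5)"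
    by (simp add: u_def round_prog_def t1_def t2_def t3_def t4_def t5_def)
  have f1: "y \<notin> assigned init \<Longrightarrow> t1 y = st y" for y unfolding t1_def by (rule den_frame)
  have f2: "y \<notin> assigned forward \<Longrightarrow> t2 y = t1 y" for y unfolding t2_def by (rule den_frame)
  have f3: "y \<notin> assigned start \<Longrightarrow> t3 y = t2 y" for y unfolding t3_def by (rule den_frame)
  have f4: "y \<notin> assigned unwind \<Longrightarrow> t4 y = t3 y" for y unfolding t4_def by (rule den_frame)
  have f5: "y \<notin> assigned tally \<Longrightarrow> t5 y = t4 y" for y unfolding t5_def by (rule den_frame)
  have m1: "t1 ''m'' 0 = m" "t2 ''m'' 0 = m" "t3 ''m'' 0 = m" "t4 ''m'' 0 = m" "t5 ''m'' 0 = m"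
    by (simp_all add: f1 f2 f3 f4 f5 m_def)
  have bs1: "t1 ''bs'' 0 = bs" "t2 ''bs'' 0 = bs" "t3 ''bs'' 0 = bs" "t4 ''bs'' 0 = bs" "t5 ''bs'' 0 = bs"
    by (simp_all add: f1 f2 f3 f4 f5 bs_def)
  have i1: "t1 ''s'' e = st ''src'' e \<and> t1 ''d'' e = st ''dst'' e" "price t1 e = x e" if "e < m" for e
    using den_init[of e st] that unfolding t1_def m_def x_def by auto
  have top1: "t1 ''top'' 0 = 0" using den_init(4)[of 0 st] m unfolding t1_def m_def by simp
  have four1: "four_graph V {..<m} (t1 ''s'') (t1 ''d'')"
    using V(1) i1 four_graph_cong[of "{..<m}" "t1 ''s''" "st ''src''" "t1 ''d''" "st ''dst''" V] by simp
  have pre: "t1 ''s'' 0 \<in> V" "price t1 0 = 0" using i1 m V by (simp_all add: x_def)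
  note fw = den_forward[of V t1, folded t2_def, unfolded m1, OF four1 V(2) pre(1) m top1 pre(2)]
  have st3: "t3 ''stA'' = t2 ''stA''" "t3 ''stB'' = t2 ''stB''" "t3 ''stC'' = t2 ''stC''" "t3 ''top'' = t2 ''top''"
    by (simp_all add: f3)
  have ok3: "stack_ok t3" using fw(2) unfolding stack_ok_def st3 m1 .
  note b3 = den_start[where st = t2, folded t3_def, unfolded m1 bs1]
  have top3: "t3 ''top'' 0 \<le> t3 ''m'' 0" using fw(3) unfolding st3 m1 .
  note b4 = den_unwind[OF ok3 top3 b3(2), folded t4_def, unfolded st3 bs1 b3(1)]
  have chi5: "u ''chi'' = t4 ''chi''" unfolding u by (simp add: fun_eq_iff f5)
  have F: "F = block t4" unfolding F_def block_def chi5 m1 bs1 ..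
  have "cheap_2ec V {..<m} (t1 ''s'') (t1 ''d'') 0 (price t1) F"
    using fw(1) unfolding F b4(1) .
  then show "cheap_2ec V {..<m} (st ''src'') (st ''dst'') 0 x F"
    using i1 cheap_2ec_cong[of "{..<m}" "t1 ''s''" "st ''src''" "t1 ''d''" "st ''dst''" 0 "price t1" x V F] by simp
  show "i < bs \<Longrightarrow> u ''chi'' i = st ''chi'' i"
    unfolding chi5 using b4(3) b3(3) by (simp add: f1 f2)
  show "u ''bs'' 0 = bs + m" unfolding u using bs1 m1 by simp
  show "u ''num'' = (st ''num'')(st ''r'' 0 := 1)"
    unfolding u by (simp add: fun_eq_iff f1 f2 f3 f4 f5)
  show "u ''N'' e = st ''N'' e + of_bool (e \<in> F)" if "e < m"
  proof -
    have "u ''N'' e = t5 ''N'' e" unfolding u by simp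
    also have "\<dots> = t4 ''N'' e + t4 ''chi'' (bs + e)"
      using den_tally[of e t4] that m1 bs1 unfolding t5_def by simp
    also have "t4 ''N'' e = st ''N'' e" by (simp add: f1 f2 f3 f4)
    also have "t4 ''chi'' (bs + e) = of_bool (e \<in> F)"
    proof -
      have "t4 ''chi'' (bs + e) \<le> 1" using b4(2) that unfolding bits_def m1 bs1 by simp
      then show ?thesis unfolding F block_def m1 bs1 using that by (cases "t4 ''chi'' (bs + e)") auto
    qed
    finally show ?thesis .
  qed
qed


section \<open>The program and its output\<close>

text \<open>In the square of \<open>x e + 3 * of_bool (e \<in> F) - 2\<close>, the cross terms sum
  to \<open>6 * sum x F - 4 * sum x (E - {z})\<close>, which is at most 0 by the cost bound on
  \<open>F\<close>, and the remaining constant is 1 or 4.\<close>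

lemma potential_step:
  fixes x y :: "'e \<Rightarrow> int"
  assumes fin: "finite E" and F: "F \<subseteq> E - {z}" and xz: "x z = 0" and yz: "y z = 0"
    and y: "\<And>e. e \<in> E - {z} \<Longrightarrow> y e = x e + 3 * of_bool (e \<in> F) - 2"
    and F': "3 * sum x F \<le> 2 * sum x (E - {z})"
  shows "(\<Sum>e\<in>E. (y e)\<^sup>2) \<le> (\<Sum>e\<in>E. (x e)\<^sup>2) + 4 * int (card E)"
proof -
  have "(\<Sum>e\<in>E. (y e)\<^sup>2) = (\<Sum>e\<in>E - {z}. (y e)\<^sup>2)"
    by (rule sum.mono_neutral_right) (use fin yz in auto)
  also have "\<dots> \<le> (\<Sum>e\<in>E - {z}. (x e)\<^sup>2 + (6 * (if e \<in> F then x e else 0) - 4 * x e) + 4)"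
    by (rule sum_mono) (auto simp: y power2_eq_square algebra_simps)
  also have "\<dots> = (\<Sum>e\<in>E - {z}. (x e)\<^sup>2) + (6 * (\<Sum>e\<in>E - {z}. if e \<in> F then x e else 0) - 4 * sum x (E - {z}))
      + 4 * int (card (E - {z}))"
    by (simp add: sum.distrib sum_subtractf sum_distrib_left)
  also have "(\<Sum>e\<in>E - {z}. if e \<in> F then x e else 0) = sum x F"
    using F fin by (simp add: sum.If_cases Int_absorb1)
  also have "(\<Sum>e\<in>E - {z}. (x e)\<^sup>2) = (\<Sum>e\<in>E. (x e)\<^sup>2)"
    by (rule sum.mono_neutral_left) (use fin xz in auto)
  finally have "(\<Sum>e\<in>E. (y e)\<^sup>2) \<le> (\<Sum>e\<in>E. (x e)\<^sup>2) + (6 * sum x F - 4 * sum x (E - {z})) + 4 * int (card (E - {z}))" .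
  moreover have "int (card (E - {z})) \<le> int (card E)" using fin by (simp add: card_Diff1_le)
  ultimately show ?thesis using F' by linarith
qed

lemma den_program:
  fixes st :: state
  defines "m \<equiv> st ''m'' 0" and "u \<equiv> den program st"
  assumes V: "four_graph V {..<m} (st ''src'') (st ''dst'')" "card V \<le> m" "st ''src'' 0 \<in> V" and m: "0 < m"
    and N0: "\<And>e. st ''N'' e = 0" and bs0: "st ''bs'' 0 = 0"
  shows "output_number u = 64 * m"
    and "j < 64 * m \<Longrightarrow> output_weight u j = 1 / real (64 * m)"
    and "j < 64 * m \<Longrightarrow> cuts_ge 2 V (output_subgraph m u j) (st ''src'') (st ''dst'')"
    and "e < m \<Longrightarrow> card {j. j < 64 * m \<and> e \<in> output_subgraph m u j} \<le> 48 * m"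
proof -
  \<comment> \<open>The round \<open>r\<close> is an argument rather than read from the state, so
    the loop invariant does not depend on the counter entry.\<close>
  define x where "x = (\<lambda>(r::nat) (t::state) e. if e = 0 then 0 else 3 * int (t ''N'' e) - 2 * int r)"
  let ?O = "output_subgraph m"
  let ?I = "\<lambda>r t. t ''bs'' 0 = r * m \<and> (\<forall>j<r. t ''num'' j = (1::nat)) \<and>
     (\<forall>j<r. 0 \<notin> ?O t j \<and> cuts_ge 2 V (?O t j) (st ''src'') (st ''dst'')) \<and>
     (\<forall>e<m. t ''N'' e = card {j. j < r \<and> e \<in> ?O t j}) \<and>
     (\<Sum>e<m. (x r t e)\<^sup>2) \<le> 4 * int m * int r"
  have rnd: "''r'' \<notin> assigned round_prog" by (simp add: round_frame)
  have "?I (64 * st ''m'' 0) (den (For ''r'' 64 round_prog) st)"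
  proof (rule For_inv[where I = ?I])
    fix r t
    assume tr: "t ''r'' 0 = r" and fr: "\<And>y. y \<notin> insert ''r'' (assigned round_prog) \<Longrightarrow> t y = st y"
      and I: "?I r t"
    have eqs: "t ''m'' 0 = m" "t ''src'' = st ''src''" "t ''dst'' = st ''dst''"
      by (simp_all add: fr round_frame m_def)
    have bs: "t ''bs'' 0 = r * m" using I by (elim conjE)
    let ?t = "den round_prog t"
    note R = den_round[of V t, unfolded eqs tr bs, OF V m]
    have O_old: "?O ?t j = ?O t j" if "j < r" for j
    proof -
      \<comment> \<open>Block \<open>j\<close> ends before block \<open>r\<close> begins, so a round
        leaves the earlier sets intact.\<close>
      have "j * m + i < r * m" if "i < m" for i
      proof -
        have "j * m + i < Suc j * m" using that by simp
        also have "\<dots> \<le> r * m" using \<open>j < r\<close> by (intro mult_le_mono1) simp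
        finally show ?thesis .
      qed
      then show ?thesis using R(3) unfolding output_subgraph_def by auto
    qed
    let ?F = "?O ?t r"
    have Feq: "{e \<in> {..<m}. ?t ''chi'' (r * m + e) = 1} = ?F"
      by (auto simp: output_subgraph_def)
    have xr: "(\<lambda>e. if e = 0 then 0 else 3 * int (t ''N'' e) - 2 * int r) = x r t"
      by (simp add: x_def)
    note R1 = R(1,2)[unfolded Feq xr]
    have F: "?F \<subseteq> {..<m} - {0}" "cuts_ge 2 V ?F (st ''src'') (st ''dst'')"
       "3 * sum (x r t) ?F \<le> 2 * sum (x r t) ({..<m} - {0})"
      using R1(1) by (auto simp: cheap_2ec_def)
    show "?I (Suc r) ?t"
    proof (intro conjI)
      show "?t ''bs'' 0 = Suc r * m" using R(4) by simp
      show "\<forall>j<Suc r. ?t ''num'' j = 1" using R(5) I by (simp add: less_Suc_eq)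
      show "\<forall>j<Suc r. 0 \<notin> ?O ?t j \<and> cuts_ge 2 V (?O ?t j) (st ''src'') (st ''dst'')"
      proof (intro allI impI)
        fix j assume "j < Suc r"
        then consider "j < r" | "j = r" by linarith
        then show "0 \<notin> ?O ?t j \<and> cuts_ge 2 V (?O ?t j) (st ''src'') (st ''dst'')"
          by cases (use I O_old F in auto)
      qed
      show "\<forall>e<m. ?t ''N'' e = card {j. j < Suc r \<and> e \<in> ?O ?t j}"
      proof (intro allI impI)
        fix e assume e: "e < m"
        have "{j. j < Suc r \<and> e \<in> ?O ?t j} = {j. j < r \<and> e \<in> ?O t j} \<union> (if e \<in> ?F then {r} else {})"
          using O_old by (auto simp: less_Suc_eq)
        moreover have "card ({j. j < r \<and> e \<in> ?O t j} \<union> (if e \<in> ?F then {r} else {}))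
            = card {j. j < r \<and> e \<in> ?O t j} + of_bool (e \<in> ?F)" by simp
        ultimately show "?t ''N'' e = card {j. j < Suc r \<and> e \<in> ?O ?t j}"
          using R1(2)[OF e] I e by simp
      qed
      have "(\<Sum>e<m. (x (Suc r) ?t e)\<^sup>2) \<le> (\<Sum>e<m. (x r t e)\<^sup>2) + 4 * int (card {..<m})"
      proof (rule potential_step[OF _ F(1) _ _ _ F(3)])
        fix e assume "e \<in> {..<m} - {0}"
        then show "x (Suc r) ?t e = x r t e + 3 * of_bool (e \<in> ?F) - 2"
          using R1(2)[of e] by (simp add: x_def)
      qed (simp_all add: x_def)
      moreover have "(\<Sum>e<m. (x r t e)\<^sup>2) \<le> 4 * int m * int r" using I by (elim conjE)
      ultimately show "(\<Sum>e<m. (x (Suc r) ?t e)\<^sup>2) \<le> 4 * int m * int (Suc r)"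
        by (simp add: algebra_simps)
    qed
  next
    have "x 0 st e = 0" for e by (simp add: x_def N0)
    then show "?I 0 st" by (simp add: bs0 N0)
    have "x i (put ''r'' 0 j t) = x i t" for i j t by (simp add: x_def put_other fun_eq_iff)
    then show "?I i (put ''r'' 0 j t) = ?I i t" for i j t
      by (simp add: output_subgraph_def)
  qed (use rnd in simp_all)
  then have I1: "?I (64 * m) (den (For ''r'' 64 round_prog) st)" unfolding m_def .
  define t where "t = den (For ''r'' 64 round_prog) st"
  note I = I1[folded t_def]
  have tm: "t ''m'' 0 = m" unfolding t_def m_def by (simp add: den_frame round_frame del: den.simps)
  have u: "u = put ''den'' 0 (64 * m) (put ''k'' 0 (64 * m) t)"
    using tm unfolding u_def program_def by (simp add: t_def)
  have Ou: "?O u = ?O t" unfolding u by (simp add: output_subgraph_def fun_eq_iff)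
  show "output_number u = 64 * m" unfolding u output_number_def by simp
  show "output_weight u j = 1 / real (64 * m)" if "j < 64 * m"
  proof -
    have "t ''num'' j = 1" using I that by blast
    then show ?thesis unfolding u output_weight_def by simp
  qed
  show "cuts_ge 2 V (?O u j) (st ''src'') (st ''dst'')" if "j < 64 * m"
    unfolding Ou using I that by blast
  show "card {j. j < 64 * m \<and> e \<in> ?O u j} \<le> 48 * m" if e: "e < m"
  proof (cases "e = 0")
    case True
    have "\<forall>j<64 * m. 0 \<notin> ?O t j" using I by blast
    then have "{j. j < 64 * m \<and> e \<in> ?O u j} = {}" unfolding Ou True by blast
    then show ?thesis by (simp only: card.empty)
  next
    case False
    have N: "t ''N'' e = card {j. j < 64 * m \<and> e \<in> ?O t j}" using I e by blast
    have sq: "(\<Sum>e<m. (x (64 * m) t e)\<^sup>2) \<le> 4 * int m * int (64 * m)" using I by blast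
    have "(x (64 * m) t e)\<^sup>2 \<le> (\<Sum>e<m. (x (64 * m) t e)\<^sup>2)"
      by (rule member_le_sum) (use e in auto)
    \<comment> \<open>This is where 64 rounds per edge enter: \<open>4 * m * (64 * m)\<close> is the
      square of \<open>16 * m\<close>. Then \<open>3 * N e \<le> 128 * m + 16 * m\<close> yields the
      bound \<open>48 * m\<close>.\<close>
    also have "\<dots> \<le> (16 * int m)\<^sup>2" using sq by (simp add: power2_eq_square)
    finally have "x (64 * m) t e \<le> 16 * int m" by (rule power2_le_imp_le) simp
    then have "t ''N'' e \<le> 48 * m" using False by (simp add: x_def)
    then show ?thesis unfolding Ou using N by simp
  qed
qed

section \<open>From connectivity of graphs to cuts and back\<close>

lemma two_card_V_le:
  assumes "four_graph V E s d"
  shows "2 * card V \<le> card E"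
proof -
  have fin: "finite V" "finite E" using assms by (auto simp: four_graph_def)
  have "4 * card V = (\<Sum>w\<in>V. valency E s d w)"
    using assms by (simp add: four_graph_def)
  also have "\<dots> = (\<Sum>e\<in>E. \<Sum>w\<in>V. of_bool (s e = w) + of_bool (d e = w))"
    unfolding valency_def by (rule sum.swap)
  also have "\<dots> \<le> (\<Sum>e\<in>E. 2)"
    by (rule sum_mono) (use fin in \<open>auto simp: sum.distrib of_bool_def\<close>)
  finally show ?thesis by simp
qed

text \<open>The edges of a cut with fewer than 4 edges could all be deleted, and then no path would
  leave \<open>S\<close>.\<close>

lemma four_graph_of_graph:
  assumes g: "graph V E ends" and ec: "edge_connected 4 V E ends" and reg: "regular 4 V E ends"
    and ends: "\<And>e. e \<in> E \<Longrightarrow> ends e = {s e, d e}"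
  shows "four_graph V E s d"
proof -
  have fin: "finite V" "finite E" using g by (auto simp: graph_def)
  have ne: "s e \<noteq> d e" "s e \<in> V" "d e \<in> V" if "e \<in> E" for e
    using g that ends[OF that] by (auto simp: graph_def card_insert_if split: if_splits)
  have val: "valency E s d w = 4" if "w \<in> V" for w
  proof -
    have "valency E s d w = (\<Sum>e\<in>E. of_bool (w \<in> ends e))"
      unfolding valency_def by (rule sum.cong) (use ne(1) ends in auto)
    also have "\<dots> = card {e\<in>E. w \<in> ends e}" using fin by (simp add: sum.If_cases Int_def)
    finally show ?thesis using reg that by (simp add: regular_def)
  qed
  have cuts: "4 \<le> card (cutset E s d S)" if S: "S \<subseteq> V" "S \<noteq> {}" "S \<noteq> V" for S
  proof (rule ccontr)
    let ?X = "cutset E s d S"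
    assume "\<not> 4 \<le> card ?X"
    then have conn: "connected_graph V (E - ?X) ends"
      using ec unfolding edge_connected_def by (auto simp: cutset_def)
    obtain a b where ab: "a \<in> S" "b \<in> V" "b \<notin> S" "a \<in> V" using S by auto
    then have "(a, b) \<in> {(x, y). \<exists>e\<in>E - ?X. ends e = {x, y}}\<^sup>*"
      using conn unfolding connected_graph_def by blast
    then have "b \<in> S"
    proof induction
      case (step y w)
      then obtain e where e: "e \<in> E - ?X" "ends e = {y, w}" by auto
      then have "{s e, d e} = {y, w}" "s e \<in> S \<longleftrightarrow> d e \<in> S"
        using ends[of e] by (auto simp: cutset_def)
      then show ?case using step.IH by (auto simp: doubleton_eq_iff)
    qed (rule ab)
    then show False using ab by simp
  qed
  show ?thesis unfolding four_graph_def cuts_ge_def using fin val cuts ne by blast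
qed

text \<open>Both connectivity clauses are the case of deleting a set \<open>X\<close> of at most one
  edge. The set reachable from \<open>u\<close> without \<open>X\<close> has its whole cut inside
  \<open>X\<close>, hence fewer than 2 cut edges, and must be \<open>V\<close>.\<close>

lemma two_ec_of_cuts:
  assumes fin: "finite E" and F: "F \<subseteq> E" and cut: "cuts_ge 2 V F s d"
    and ends: "\<And>e. e \<in> E \<Longrightarrow> ends e = {s e, d e}" "\<And>e. e \<in> E \<Longrightarrow> s e \<in> V \<and> d e \<in> V"
  shows "two_ec_spanning_subgraph V E ends F"
proof -
  have conn: "connected_graph V (F - X) ends" if X: "card X \<le> 1" "finite X" for X
    unfolding connected_graph_def
  proof (intro ballI)
    fix u v assume u: "u \<in> V" and v: "v \<in> V"
    let ?r = "{(x, y). \<exists>e\<in>F - X. ends e = {x, y}}"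
    define S where "S = {w \<in> V. (u, w) \<in> ?r\<^sup>*}"
    have step: "w' \<in> S" if "e \<in> F - X" "ends e = {w, w'}" "w \<in> S" "w' \<in> V" for e w w'
      using that unfolding S_def by (auto intro: rtrancl_into_rtrancl)
    have closed: "cutset F s d S \<subseteq> X"
    proof
      fix e assume e: "e \<in> cutset F s d S"
      show "e \<in> X"
      proof (rule ccontr)
        assume "e \<notin> X"
        then have "e \<in> F - X" "e \<in> E" using e F by (auto simp: cutset_def)
        then show False
          using step[of e "s e" "d e"] step[of e "d e" "s e"] ends[of e] e
          by (auto simp: cutset_def insert_commute)
      qed
    qed
    have "S = V"
    proof (rule ccontr)
      assume "S \<noteq> V"
      moreover have "S \<subseteq> V" "S \<noteq> {}" using u by (auto simp: S_def)
      ultimately have "2 \<le> card (cutset F s d S)" using cut by (simp add: cuts_ge_def)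
      also have "\<dots> \<le> card X" using closed X by (intro card_mono)
      finally show False using X by simp
    qed
    then show "(u, v) \<in> ?r\<^sup>*" using v by (auto simp: S_def)
  qed
  show ?thesis
    unfolding two_ec_spanning_subgraph_def
    using F conn[of "{}"] conn[of "{e}" for e] by simp
qed

text \<open>Equal weights turn each count into a frequency, and \<open>48 * m\<close> out of
  \<open>64 * m\<close> is 3/4.\<close>

lemma dominates_of_counts:
  assumes T: "0 < m" and F: "\<And>j. j < 64 * m \<Longrightarrow> two_ec_spanning_subgraph V E ends (F j)"
    and w: "\<And>j. j < 64 * m \<Longrightarrow> w j = 1 / real (64 * m)"
    and count: "\<And>e. e \<in> E \<Longrightarrow> card {j. j < 64 * m \<and> e \<in> F j} \<le> 48 * m"
  shows "dominates_two_ec_combination V E ends (everywhere (3/4)) (64 * m) w F"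
proof -
  define x where "x e = (\<Sum>j<64 * m. w j * indicator (F j) e)" for e
  have "x e \<le> 3/4" if e: "e \<in> E" for e
  proof -
    have "x e = (\<Sum>j<64 * m. 1 / real (64 * m) * of_bool (e \<in> F j))"
      unfolding x_def by (rule sum.cong) (auto simp: w indicator_def)
    also have "\<dots> = 1 / real (64 * m) * real (card {j. j < 64 * m \<and> e \<in> F j})"
    proof -
      have "(\<Sum>j<64 * m. of_bool (e \<in> F j)) = real (card {j. j < 64 * m \<and> e \<in> F j})"
        by (simp add: Int_def)
      then show ?thesis by (simp only: flip: sum_distrib_left)
    qed
    also have "\<dots> \<le> 1 / real (64 * m) * real (48 * m)"
      using count[OF e] by (intro mult_left_mono) (simp_all only: of_nat_le_iff, simp)
    also have "\<dots> = 3/4" using T by simp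
    finally show ?thesis .
  qed
  moreover have "(\<Sum>j<64 * m. w j) = 1" using T w by simp
  ultimately have "convex_combination_of_incidence E (64 * m) w F x" "dominates E (everywhere (3/4)) x"
    using w unfolding convex_combination_of_incidence_def dominates_def everywhere_def x_def by auto
  then show ?thesis using F unfolding dominates_two_ec_combination_def by blast
qed

lemma program_on_list:
  fixes n :: nat and es :: "(nat \<times> nat) list"
  defines "m \<equiv> length es" and "s \<equiv> \<lambda>i. fst (es ! i)" and "d \<equiv> \<lambda>i. snd (es ! i)"
    and "u \<equiv> den program (input_state n es)"
  assumes four: "four_graph V {..<m} s d" and V: "V \<noteq> {}" "\<forall>e<m. s e \<in> V"
  shows "0 < m" "output_number u = 64 * m"
    and "j < 64 * m \<Longrightarrow> output_weight u j = 1 / real (64 * m)"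
    and "j < 64 * m \<Longrightarrow> cuts_ge 2 V (output_subgraph m u j) s d"
    and "e < m \<Longrightarrow> card {j. j < 64 * m \<and> e \<in> output_subgraph m u j} \<le> 48 * m"
proof -
  let ?st = "input_state n es"
  have "finite V" using four by (simp add: four_graph_def)
  then have "card V \<noteq> 0" using V by simp
  \<comment> \<open>All loops run a multiple of \<open>m\<close> rounds, so the number of vertices
    has to be bounded by \<open>m\<close>.\<close>
  moreover have "2 * card V \<le> m" using two_card_V_le[OF four] by simp
  ultimately have card: "card V \<le> m" and "0 < m" by linarith+
  then show m: "0 < m" by simp
  have eqs: "?st ''m'' 0 = m" "?st ''bs'' 0 = 0" "\<And>e. ?st ''N'' e = 0"
    "\<And>e. e < m \<Longrightarrow> ?st ''src'' e = s e" "\<And>e. e < m \<Longrightarrow> ?st ''dst'' e = d e"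
    by (simp_all add: input_state_def m_def s_def d_def)
  have four': "four_graph V {..<m} (?st ''src'') (?st ''dst'')"
    using four four_graph_cong[of "{..<m}" s "?st ''src''" d "?st ''dst''" V] eqs by simp
  have s0: "?st ''src'' 0 \<in> V" using eqs m V by simp
  note D = den_program[of V ?st, unfolded eqs(1), folded u_def, OF four' card s0 m eqs(3,2)]
  show "output_number u = 64 * m" by (rule D(1))
  show "j < 64 * m \<Longrightarrow> output_weight u j = 1 / real (64 * m)" by (rule D(2))
  show "e < m \<Longrightarrow> card {j. j < 64 * m \<and> e \<in> output_subgraph m u j} \<le> 48 * m" by (rule D(4))
  show "cuts_ge 2 V (output_subgraph m u j) s d" if "j < 64 * m"
  proof -
    have "cuts_ge 2 V (output_subgraph m u j) (?st ''src'') (?st ''dst'')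
        = cuts_ge 2 V (output_subgraph m u j) s d"
      by (rule cuts_ge_cong) (use eqs in \<open>auto simp: output_subgraph_def\<close>)
    then show ?thesis using D(3)[OF that] by simp
  qed
qed

section \<open>Relabelling vertices and edges\<close>

lemma card_cutset_relabel:
  assumes g: "inj_on g V" and f: "inj_on f I" and ends: "\<And>i. i \<in> I \<Longrightarrow> s (f i) \<in> V \<and> d (f i) \<in> V"
    and S: "S \<subseteq> V"
  shows "card (cutset I (\<lambda>i. g (s (f i))) (\<lambda>i. g (d (f i))) (g ` S)) = card (cutset (f ` I) s d S)"
proof -
  have "cutset (f ` I) s d S = f ` cutset I (\<lambda>i. g (s (f i))) (\<lambda>i. g (d (f i))) (g ` S)"
  proof -
    have "g (s (f i)) \<in> g ` S \<longleftrightarrow> s (f i) \<in> S" "g (d (f i)) \<in> g ` S \<longleftrightarrow> d (f i) \<in> S" if "i \<in> I" for i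
      using ends[OF that] S by (simp_all only: inj_on_image_mem_iff[OF g])
    then show ?thesis unfolding cutset_def by blast
  qed
  moreover have "inj_on f (cutset I (\<lambda>i. g (s (f i))) (\<lambda>i. g (d (f i))) (g ` S))"
    using f by (rule inj_on_subset) (auto simp: cutset_def)
  ultimately show ?thesis by (simp add: card_image)
qed

lemma cuts_ge_relabel:
  assumes g: "inj_on g V" and f: "inj_on f I" and ends: "\<And>i. i \<in> I \<Longrightarrow> s (f i) \<in> V \<and> d (f i) \<in> V"
  shows "cuts_ge k (g ` V) I (\<lambda>i. g (s (f i))) (\<lambda>i. g (d (f i))) \<longleftrightarrow> cuts_ge k V (f ` I) s d"
proof -
  have "cuts_ge k (g ` V) I (\<lambda>i. g (s (f i))) (\<lambda>i. g (d (f i))) \<longleftrightarrow>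
     (\<forall>S\<subseteq>V. g ` S \<noteq> {} \<longrightarrow> g ` S \<noteq> g ` V \<longrightarrow>
        k \<le> card (cutset I (\<lambda>i. g (s (f i))) (\<lambda>i. g (d (f i))) (g ` S)))"
    unfolding cuts_ge_def by (rule all_subset_image)
  also have "\<dots> \<longleftrightarrow> (\<forall>S\<subseteq>V. S \<noteq> {} \<longrightarrow> S \<noteq> V \<longrightarrow> k \<le> card (cutset (f ` I) s d S))"
    using inj_on_image_eq_iff[OF g] card_cutset_relabel[where s = s and d = d, OF g f ends] by auto
  finally show ?thesis by (simp add: cuts_ge_def)
qed

lemma four_graph_relabel:
  assumes four: "four_graph V (f ` I) s d" and g: "inj_on g V" and f: "inj_on f I"
    and ends: "\<And>i. i \<in> I \<Longrightarrow> s (f i) \<in> V \<and> d (f i) \<in> V"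
  shows "four_graph (g ` V) I (\<lambda>i. g (s (f i))) (\<lambda>i. g (d (f i)))"
proof -
  have "valency I (\<lambda>i. g (s (f i))) (\<lambda>i. g (d (f i))) (g w) = 4" if w: "w \<in> V" for w
  proof -
    have "valency I (\<lambda>i. g (s (f i))) (\<lambda>i. g (d (f i))) (g w) = valency (f ` I) s d w"
      unfolding valency_def sum.reindex[OF f] o_def
      by (rule sum.cong) (use w ends in \<open>auto simp: inj_on_eq_iff[OF g]\<close>)
    then show ?thesis using four w by (simp add: four_graph_def)
  qed
  then show ?thesis
    using four ends cuts_ge_relabel[where s = s and d = d and k = 4, OF g f ends] finite_image_iff[OF f]
    unfolding four_graph_def by auto
qed

theorem theorem11:
  "(\<forall>(V :: 'v set) (E :: 'e set) ends.
      graph V E ends \<and> edge_connected 4 V E ends \<and> regular 4 V E ends \<longrightarrow>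
      (\<exists>k w F. dominates_two_ec_combination V E ends (everywhere (3/4)) k w F))
   \<and>
   (\<exists>(prog :: com) (p :: nat poly). \<forall>(n :: nat) (es :: (nat \<times> nat) list).
      graph {..<n} {..<length es} (list_ends es) \<and>
      edge_connected 4 {..<n} {..<length es} (list_ends es) \<and>
      regular 4 {..<n} {..<length es} (list_ends es) \<longrightarrow>
      (\<exists>t s. exec prog (input_state n es) t s \<and>
         t \<le> poly p (n + length es) \<and>
         dominates_two_ec_combination {..<n} {..<length es} (list_ends es) (everywhere (3/4))
           (output_number s) (output_weight s) (output_subgraph (length es) s)))"
proof (intro conjI allI impI)
  fix V :: "'v set" and E :: "'e set" and ends
  assume G: "graph V E ends \<and> edge_connected 4 V E ends \<and> regular 4 V E ends"
  then have fin: "finite V" "finite E" and V: "V \<noteq> {}" by (auto simp: graph_def)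
  have "\<forall>e\<in>E. \<exists>a b. ends e = {a, b}" using G unfolding graph_def card_2_iff by blast
  then obtain s d where sd: "\<And>e. e \<in> E \<Longrightarrow> ends e = {s e, d e}" by metis
  have inV: "s e \<in> V \<and> d e \<in> V" if "e \<in> E" for e
    using G sd[OF that] that by (auto simp: graph_def)
  have four: "four_graph V E s d" using G by (intro four_graph_of_graph[of V E ends] sd) auto
  \<comment> \<open>With edges numbered by \<open>f\<close> and vertices by \<open>g\<close>, the
    program can be run on a copy of the graph. Existence for arbitrary types thus follows from the
    analysis of the algorithm.\<close>
  obtain f where f: "bij_betw f {..<card E} E"
    using fin(2) by (metis ex_bij_betw_nat_finite lessThan_atLeast0)
  obtain g :: "'v \<Rightarrow> nat" where g: "inj_on g V"
    using fin(1) by (metis bij_betw_imp_inj_on ex_bij_betw_finite_nat)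
  let ?m = "card E"
  define es where "es = map (\<lambda>i. (g (s (f i)), g (d (f i)))) [0..<?m]"
  have len: "length es = ?m" by (simp add: es_def)
  have fE: "f ` {..<?m} = E" and inj: "inj_on f {..<?m}" using f by (auto simp: bij_betw_def)
  then have endsI: "s (f i) \<in> V \<and> d (f i) \<in> V" if "i \<in> {..<?m}" for i
    using inV that by blast
  have es: "fst (es ! i) = g (s (f i))" "snd (es ! i) = g (d (f i))" if "i < ?m" for i
    using that by (simp_all add: es_def)
  have "four_graph (g ` V) {..<?m} (\<lambda>i. g (s (f i))) (\<lambda>i. g (d (f i)))"
    by (rule four_graph_relabel[where s = s and d = d, OF _ g inj endsI]) (simp_all only: fE four)
  then have four': "four_graph (g ` V) {..<length es} (\<lambda>i. fst (es ! i)) (\<lambda>i. snd (es ! i))"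
    unfolding len using four_graph_cong[of "{..<?m}" "\<lambda>i. fst (es ! i)" "\<lambda>i. g (s (f i))"
        "\<lambda>i. snd (es ! i)" "\<lambda>i. g (d (f i))"] es by simp
  have "g ` V \<noteq> {}" "\<forall>e<length es. fst (es ! e) \<in> g ` V"
    using V es endsI len by auto
  note P = program_on_list[OF four' this, unfolded len]
  \<comment> \<open>The sets found are carried back along \<open>f\<close>. The argument
    \<open>0\<close> of \<open>input_state\<close> is an arbitrary choice, since
    \<open>program_on_list\<close> holds for every \<open>n\<close>.\<close>
  define F where "F j = f ` output_subgraph ?m (den program (input_state 0 es)) j" for j
  have sub: "output_subgraph ?m t j \<subseteq> {..<?m}" for t j by (auto simp: output_subgraph_def)
  have "two_ec_spanning_subgraph V E ends (F j)" if j: "j < 64 * ?m" for j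
  proof (rule two_ec_of_cuts[OF fin(2) _ _ sd inV])
    let ?I = "output_subgraph ?m (den program (input_state 0 es)) j"
    show "F j \<subseteq> E" using sub fE unfolding F_def by blast
    have "cuts_ge 2 (g ` V) ?I (\<lambda>i. g (s (f i))) (\<lambda>i. g (d (f i)))"
      using P(4)[OF j, of 0] cuts_ge_cong[of ?I "\<lambda>i. fst (es ! i)" "\<lambda>i. g (s (f i))"
        "\<lambda>i. snd (es ! i)" "\<lambda>i. g (d (f i))"] es sub by (auto simp: subset_iff)
    moreover have "inj_on f ?I" using inj sub by (rule inj_on_subset)
    ultimately show "cuts_ge 2 V (F j) s d"
      unfolding F_def using cuts_ge_relabel[where s = s and d = d and k = 2 and f = f and I = ?I, OF g] endsI sub by blast
  qed
  moreover have "card {j. j < 64 * ?m \<and> e \<in> F j} \<le> 48 * ?m" if e: "e \<in> E" for e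
  proof -
    obtain i where i: "i < ?m" "e = f i" using e fE by auto
    have "e \<in> F j \<longleftrightarrow> i \<in> output_subgraph ?m (den program (input_state 0 es)) j" for j
      unfolding F_def i(2) using inj i(1) sub by (intro inj_on_image_mem_iff[of f "{..<?m}"]) auto
    then show ?thesis using P(5)[OF i(1), of 0] by simp
  qed
  ultimately have "dominates_two_ec_combination V E ends (everywhere (3/4)) (64 * ?m) (\<lambda>_. 1 / real (64 * ?m)) F"
    using P(1) by (intro dominates_of_counts) auto
  then show "\<exists>k w F. dominates_two_ec_combination V E ends (everywhere (3/4)) k w F" by blast
next
  have "\<exists>t s. exec (compile program) (input_state n es) t s \<and> t \<le> poly (cost program) (n + length es) \<and>
         dominates_two_ec_combination {..<n} {..<length es} (list_ends es) (everywhere (3/4))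
           (output_number s) (output_weight s) (output_subgraph (length es) s)"
    if G: "graph {..<n} {..<length es} (list_ends es) \<and>
      edge_connected 4 {..<n} {..<length es} (list_ends es) \<and>
      regular 4 {..<n} {..<length es} (list_ends es)" for n es
  proof -
    let ?m = "length es" and ?u = "den program (input_state n es)"
    let ?s = "\<lambda>i. fst (es ! i)" and ?d = "\<lambda>i. snd (es ! i)"
    have ends: "list_ends es e = {?s e, ?d e}" for e by (simp add: list_ends_def)
    have inV: "?s e \<in> {..<n} \<and> ?d e \<in> {..<n}" if "e \<in> {..<?m}" for e
      using G that ends[of e] by (auto simp: graph_def)
    have four: "four_graph {..<n} {..<?m} ?s ?d"
      using G ends by (intro four_graph_of_graph[of _ _ "list_ends es"]) auto
    have nonempty: "{..<n} \<noteq> {}" using G unfolding graph_def by blast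
    have sV: "\<forall>e<?m. ?s e \<in> {..<n}" using inV by simp
    note P = program_on_list[OF four nonempty sV]
    obtain t where t: "exec (compile program) (input_state n es) t ?u"
      "t \<le> poly (cost program) (input_state n es ''m'' 0)"
      using exec_compile[of program "input_state n es"] by auto
    \<comment> \<open>The time bound is a polynomial in \<open>m\<close> with natural coefficients,
      hence monotone.\<close>
    have "t \<le> poly (cost program) (n + ?m)"
    proof -
      have "input_state n es ''m'' 0 \<le> n + ?m" by (simp add: input_state_def)
      then show ?thesis using t(2) poly_nat_mono le_trans by blast
    qed
    moreover have "dominates_two_ec_combination {..<n} {..<?m} (list_ends es) (everywhere (3/4))
           (output_number ?u) (output_weight ?u) (output_subgraph ?m ?u)"
      unfolding P(2)
    proof (rule dominates_of_counts[OF P(1) _ P(3)])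
      show "two_ec_spanning_subgraph {..<n} {..<?m} (list_ends es) (output_subgraph ?m ?u j)"
        if "j < 64 * ?m" for j
        by (rule two_ec_of_cuts[OF _ _ P(4)[OF that] ends inV]) (auto simp: output_subgraph_def)
      show "card {j. j < 64 * ?m \<and> e \<in> output_subgraph ?m ?u j} \<le> 48 * ?m" if "e \<in> {..<?m}" for e
        using P(5)[of e n] that by simp
    qed
    ultimately show ?thesis using t(1) by blast
  qed
  then show "\<exists>(prog :: com) (p :: nat poly). \<forall>(n :: nat) (es :: (nat \<times> nat) list).
      graph {..<n} {..<length es} (list_ends es) \<and>
      edge_connected 4 {..<n} {..<length es} (list_ends es) \<and>
      regular 4 {..<n} {..<length es} (list_ends es) \<longrightarrow>
      (\<exists>t s. exec prog (input_state n es) t s \<and>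
         t \<le> poly p (n + length es) \<and>
         dominates_two_ec_combination {..<n} {..<length es} (list_ends es) (everywhere (3/4))
           (output_number s) (output_weight s) (output_subgraph (length es) s))"
    by blast
qed

end
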